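(* Let $M_\alpha(t)$ be the minimal polynomial of $\alpha$ over $\mathbb{K}$. Let $m_\alpha(t)=\frac{M_\alpha(t)}{t-\alpha}=\sum_{i=0}^{n-1}l_it^i\in\mathbb{K}(\alpha)[t]$, where $l_{n-1}=1$. Then the points at infinity of every primitive $\alpha$-hypercircle are $[l_0:l_1:\cdots:l_{n-2}:l_{n-1}:0]$ and its conjugates.
   Context: $\mathbb{K}$ is a field of characteristic zero, $\mathbb{L}=\mathbb{K}(\alpha)$ is a finite algebraic extension of $\mathbb{K}$ of degree $n$ with primitive element $\alpha$, and $\mathbb{F}$ is the algebraic closure of $\mathbb{K}$. A unit of $\mathbb{L}(t)$ (under composition) is a rational function $u(t)=\frac{at+b}{ct+d}$ with $a,b,c,d\in\mathbb{L}$, $ad-bc\neq 0$. Every unit $u(t)\in\mathbb{L}(t)$ is written uniquely as $u(t)=\sum_{i=0}^{n-1}\phi_i(t)\alpha^i$ with $\phi_i(t)\in\mathbb{K}(t)$, and the $\alpha$-hypercircle generated by $u(t)$ is the rational curve in $\mathbb{F}^n$ parametrized by $(\phi_0(t),\ldots,\phi_{n-1}(t))$ (Zariski closure of the image). An $\alpha$-hypercircle is primitive if its degree as a curve equals $n=[\mathbb{K}(\alpha):\mathbb{K}]$. $\mathbb{F}^n$ is embedded in $\mathbb{P}(\mathbb{F})^n$ via $(X_0,\ldots,X_{n-1})\mapsto[X_0:\cdots:X_{n-1}:1]$; the points at infinity of a curve are the points of its projective closure in the hyperplane $\{X_n=0\}$. The conjugates of a projective point are obtained by applying the $\mathbb{K}$-automorphisms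 of the normal closure of $\mathbb{L}$ over $\mathbb{K}$ to its coordinates. *)

theory Defs
  imports
    "HOL-Algebra.Algebraic_Closure_Type"
    "HOL-Algebra.Generated_Fields"
    "HOL-Computational_Algebra.Fraction_Field"
    "HOL-Library.Poly_Mapping"
    "Jordan_Normal_Form.Matrix"
begin

hide_const (open) Poly_Mapping.degree Poly_Mapping.range UnivPoly.coeff UnivPoly.monom

text \<open>
  The base field is a type of class \<open>field_char_0\<close>; its algebraic closure is the library
  type \<open>'k alg_closure\<close>, into which \<open>to_ac\<close> embeds it. All intermediate fields are
  subsets of \<open>'k alg_closure\<close>.
\<close>

section \<open>Field extensions\<close>

abbreviation base_field :: "'k::field alg_closure set" where
  "base_field \<equiv> range to_ac"

definition simple_ext :: "'k::field alg_closure \<Rightarrow> 'k alg_closure set" where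
  "simple_ext \<alpha> = generate_field ring_of_type_algebra (base_field \<union> {\<alpha>})"

definition ext_degree :: "'k::field alg_closure \<Rightarrow> nat" where
  "ext_degree \<alpha> = vector_space.dim (\<lambda>k x. to_ac k * x) (simple_ext \<alpha>)"

definition min_poly :: "'k::field alg_closure \<Rightarrow> 'k poly" where
  "min_poly x = (THE p. lead_coeff p = 1 \<and> poly (map_poly to_ac p) x = 0 \<and>
     (\<forall>q. q \<noteq> 0 \<and> poly (map_poly to_ac q) x = 0 \<longrightarrow> degree p \<le> degree q))"

text \<open>Algebraicity over the base field is automatic inside \<open>'k alg_closure\<close>.\<close>

definition normal_ext :: "'k::field alg_closure set \<Rightarrow> bool" where
  "normal_ext N \<longleftrightarrow> subfield N ring_of_type_algebra \<and> base_field \<subseteq> N \<and>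
     (\<forall>p :: 'k poly. irreducible p \<and> (\<exists>x\<in>N. poly (map_poly to_ac p) x = 0) \<longrightarrow>
        (\<forall>x. poly (map_poly to_ac p) x = 0 \<longrightarrow> x \<in> N))"

definition normal_closure :: "'k::field alg_closure set \<Rightarrow> 'k alg_closure set" where
  "normal_closure E = \<Inter>{N. normal_ext N \<and> E \<subseteq> N}"

text \<open>Only the values of \<open>\<sigma>\<close> on \<open>N\<close> matter.\<close>

definition is_base_automorphism ::
    "'k::field alg_closure set \<Rightarrow> ('k alg_closure \<Rightarrow> 'k alg_closure) \<Rightarrow> bool" where
  "is_base_automorphism N \<sigma> \<longleftrightarrow> bij_betw \<sigma> N N \<and> (\<forall>k. \<sigma> (to_ac k) = to_ac k) \<and>
     (\<forall>x\<in>N. \<forall>y\<in>N. \<sigma> (x + y) = \<sigma> x + \<sigma> y \<and> \<sigma> (x * y) = \<sigma> x * \<sigma> y)"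


section \<open>Affine and projective algebraic sets\<close>

text \<open>
  Polynomials in the variables \<open>X\<^sub>0, X\<^sub>1, \<dots>\<close>: finitely supported maps from exponent
  vectors to coefficients. Affine \<open>n\<close>-space is \<open>carrier_vec n\<close>.
\<close>

type_synonym 'a multipoly = "(nat \<Rightarrow>\<^sub>0 nat) \<Rightarrow>\<^sub>0 'a"

definition multipolys :: "nat \<Rightarrow> 'a::zero multipoly set" where
  "multipolys n = {p. \<forall>m\<in>Poly_Mapping.keys p. Poly_Mapping.keys m \<subseteq> {..<n}}"

definition eval_mp :: "'a::comm_semiring_1 multipoly \<Rightarrow> 'a vec \<Rightarrow> 'a" where
  "eval_mp p v = (\<Sum>m\<in>Poly_Mapping.keys p. Poly_Mapping.lookup p m * (\<Prod>i\<in>Poly_Mapping.keys m. (v $ i) ^ Poly_Mapping.lookup m i))"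

definition homogeneous_mp :: "'a::zero multipoly \<Rightarrow> bool" where
  "homogeneous_mp p \<longleftrightarrow> (\<exists>d. \<forall>m\<in>Poly_Mapping.keys p. (\<Sum>i\<in>Poly_Mapping.keys m. Poly_Mapping.lookup m i) = d)"

definition zariski_closure :: "nat \<Rightarrow> 'a::comm_semiring_1 vec set \<Rightarrow> 'a vec set" where
  "zariski_closure n S =
     {x \<in> carrier_vec n. \<forall>p\<in>multipolys n. (\<forall>y\<in>S. eval_mp p y = 0) \<longrightarrow> eval_mp p x = 0}"

text \<open>
  A point of projective \<open>n\<close>-space is represented by the set of all its vectors of
  homogeneous coordinates.
\<close>

definition proj_point :: "'a::field vec \<Rightarrow> 'a vec set" where
  "proj_point v = {c \<cdot>\<^sub>v v | c. c \<noteq> 0}"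

definition proj_space :: "nat \<Rightarrow> 'a::field vec set set" where
  "proj_space n = {proj_point v | v. v \<in> carrier_vec (n + 1) \<and> v \<noteq> 0\<^sub>v (n + 1)}"

definition affine_embed :: "nat \<Rightarrow> 'a::field vec \<Rightarrow> 'a vec" where
  "affine_embed n x = vec (n + 1) (\<lambda>i. if i < n then x $ i else 1)"

definition proj_closure :: "nat \<Rightarrow> 'a::field vec set \<Rightarrow> 'a vec set set" where
  "proj_closure n Z = {P \<in> proj_space n. \<forall>p\<in>multipolys (n + 1).
     homogeneous_mp p \<and> (\<forall>x\<in>Z. eval_mp p (affine_embed n x) = 0) \<longrightarrow>
       (\<forall>v\<in>P. eval_mp p v = 0)}"

definition points_at_infinity :: "nat \<Rightarrow> 'a::field vec set \<Rightarrow> 'a vec set set" where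
  "points_at_infinity n Z = {P \<in> proj_closure n Z. \<forall>v\<in>P. v $ n = 0}"

definition hyperplane :: "nat \<Rightarrow> 'a::field vec \<Rightarrow> 'a vec set set" where
  "hyperplane n a = {P \<in> proj_space n. \<forall>v\<in>P. a \<bullet> v = 0}"

text \<open>
  The degree of a curve (over an algebraically closed field) is the number of points in which
  its projective closure meets a generic hyperplane, i.e. any hyperplane whose coefficient
  vector lies outside the zero set of some nonzero polynomial \<open>G\<close>.
\<close>

definition curve_has_degree :: "nat \<Rightarrow> 'a::field vec set \<Rightarrow> nat \<Rightarrow> bool" where
  "curve_has_degree n Z d \<longleftrightarrow> (\<exists>G\<in>multipolys (n + 1). G \<noteq> 0 \<and>
     (\<forall>a\<in>carrier_vec (n + 1). a \<noteq> 0\<^sub>v (n + 1) \<and> eval_mp G a \<noteq> 0 \<longrightarrow>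
        finite (proj_closure n Z \<inter> hyperplane n a) \<and>
        card (proj_closure n Z \<inter> hyperplane n a) = d))"

text \<open>
  The conjugates of a point \<open>P\<close> are obtained from those homogeneous coordinates of \<open>P\<close>
  that lie in \<open>N\<close>; two such coordinate vectors differ by a factor in \<open>N\<close>, so the conjugate
  by a given automorphism does not depend on the choice.
\<close>

definition conjugate_points ::
    "'k::field alg_closure set \<Rightarrow> 'k alg_closure vec set \<Rightarrow> 'k alg_closure vec set set" where
  "conjugate_points N P = {proj_point (map_vec \<sigma> v) | \<sigma> v.
     is_base_automorphism N \<sigma> \<and> v \<in> P \<and> (\<forall>i<dim_vec v. v $ i \<in> N)}"


section \<open>Hypercircles\<close>

definition rat_funs :: "'a::field set \<Rightarrow> 'a poly fract set" where
  "rat_funs S = {Fract p q | p q.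
     q \<noteq> 0 \<and> (\<forall>i. poly.coeff p i \<in> S) \<and> (\<forall>i. poly.coeff q i \<in> S)}"

text \<open>\<open>rat_fun_value f t y\<close>: the rational function \<open>f\<close> is defined at \<open>t\<close> with value \<open>y\<close>.\<close>

definition rat_fun_value :: "'a::field poly fract \<Rightarrow> 'a \<Rightarrow> 'a \<Rightarrow> bool" where
  "rat_fun_value f t y \<longleftrightarrow>
     (\<exists>p q. f = Fract p q \<and> poly q t \<noteq> 0 \<and> y = poly p t / poly q t)"

definition unit_funs :: "'a::field set \<Rightarrow> 'a poly fract set" where
  "unit_funs S = {Fract [:b, a:] [:d, c:] | a b c d.
     a \<in> S \<and> b \<in> S \<and> c \<in> S \<and> d \<in> S \<and> a * d - b * c \<noteq> 0}"

definition components ::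
    "'k::field alg_closure \<Rightarrow> 'k alg_closure poly fract \<Rightarrow> (nat \<Rightarrow> 'k alg_closure poly fract) \<Rightarrow> bool"
  where
  "components \<alpha> u \<phi> \<longleftrightarrow> (\<forall>i<ext_degree \<alpha>. \<phi> i \<in> rat_funs base_field) \<and>
     u = (\<Sum>i<ext_degree \<alpha>. \<phi> i * Fract [:\<alpha> ^ i:] 1)"

definition rat_param_image ::
    "nat \<Rightarrow> (nat \<Rightarrow> 'a::field poly fract) \<Rightarrow> 'a vec set" where
  "rat_param_image n \<phi> = {x \<in> carrier_vec n. \<exists>t. \<forall>i<n. rat_fun_value (\<phi> i) t (x $ i)}"

definition hypercircle :: "'k::field alg_closure \<Rightarrow> 'k alg_closure vec set \<Rightarrow> bool" where
  "hypercircle \<alpha> C \<longleftrightarrow> (\<exists>u \<phi>. u \<in> unit_funs (simple_ext \<alpha>) \<and> components \<alpha> u \<phi> \<and>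
     C = zariski_closure (ext_degree \<alpha>) (rat_param_image (ext_degree \<alpha>) \<phi>))"

definition primitive_hypercircle ::
    "'k::field alg_closure \<Rightarrow> 'k alg_closure vec set \<Rightarrow> bool" where
  "primitive_hypercircle \<alpha> C \<longleftrightarrow>
     hypercircle \<alpha> C \<and> curve_has_degree (ext_degree \<alpha>) C (ext_degree \<alpha>)"

end

theory Submission
  imports Defs
begin

text \<open>
  Let \<open>R\<close> be the set of conjugates of \<open>\<alpha>\<close>. The linear coordinates \<open>y \<beta> x = (\<Sum>i<n. x\<^sub>i * \<beta> ^ i)\<close>,
  \<open>\<beta> \<in> R\<close>, take the hypercircle of \<open>u\<close> to the curve whose coordinates are the conjugates of
  \<open>u\<close>, each of the form \<open>A \<beta> + B \<beta> / (s + \<delta> \<beta>)\<close>. Pairwise elimination of \<open>s\<close> gives quadrics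
  which show that, when the \<open>\<delta> \<beta>\<close> are distinct, exactly one \<open>y \<beta>\<close> is nonzero at a point at
  infinity; this is the point given by the coefficients of \<open>M\<^sub>\<alpha>(t) / (t - \<beta>)\<close>, and it is reached at
  \<open>s = - \<delta> \<beta>\<close>. If the \<open>\<delta> \<beta>\<close> take fewer than \<open>n\<close> values, a generic hyperplane meets the curve in
  fewer than \<open>n\<close> points, so the hypercircle is not primitive. Finally, every conjugate \<open>\<beta>\<close> is the image of \<open>\<alpha>\<close>
  under an automorphism of the normal closure.
\<close>

no_notation fps_nth (infixl \<open>$\<close> 75)

section \<open>Polynomials over the base field\<close>

text \<open>The forms vanishing on the curve are never computed. Bounding its projective closure
  from above uses only the quadrics and, for equal values of \<open>\<delta>\<close>, linear forms.
  Points are shown to lie in the closure by clearing denominators: a form restricted to a polynomial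
  path is a univariate polynomial, so if it vanishes off a finite set it also vanishes at the pole.

  A unit with \<open>c = 0\<close> has its pole at parameter infinity. Inverting the parameter gives
  it the common shape with every \<open>\<delta> \<beta>\<close> equal to 0, so the degree argument
  covers it: for \<open>n > 1\<close> it is not primitive, and for \<open>n = 1\<close> injectivity
  of \<open>\<delta>\<close> is trivial.

  Conjugating the identity between \<open>u\<close> and its components directly would need an action
  on rational functions. Instead the identity is evaluated at parameters from the base field, where
  it becomes a polynomial relation for \<alpha> over that field, and such relations hold at every
  conjugate.\<close>

definition ev :: "'k::field poly \<Rightarrow> 'k alg_closure \<Rightarrow> 'k alg_closure" where
  "ev p x = poly (map_poly to_ac p) x"

lemma ev_0 [simp]: "ev 0 x = 0"
  by (simp add: ev_def)

lemma ev_pCons [simp]: "ev (pCons a p) x = to_ac a + x * ev p x"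
  by (simp add: ev_def map_poly_pCons)

lemma ev_1 [simp]: "ev 1 x = 1"
  by (simp add: one_pCons)

lemma ev_add [simp]: "ev (p + q) x = ev p x + ev q x"
proof (induction p arbitrary: q)
  case (pCons a p)
  then show ?case by (cases q) (simp add: algebra_simps)
qed simp

lemma ev_smult [simp]: "ev (smult c p) x = to_ac c * ev p x"
  by (induction p) (simp_all add: algebra_simps)

lemma ev_mult [simp]: "ev (p * q) x = ev p x * ev q x"
  by (induction p) (simp_all add: algebra_simps)

lemma ev_minus [simp]: "ev (- p) x = - ev p x"
  using ev_smult[of "-1" p x] by simp

lemma ev_diff [simp]: "ev (p - q) x = ev p x - ev q x"
  using ev_add[of p "-q" x] by simp

lemma ev_sum: "ev (sum f A) x = (\<Sum>i\<in>A. ev (f i) x)"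
  by (induction A rule: infinite_finite_induct) auto

lemma ev_monom [simp]: "ev (Polynomial.monom c i) x = to_ac c * x ^ i"
  by (simp add: ev_def map_poly_monom poly_monom)

lemma ev_to_ac: "ev p (to_ac k) = to_ac (poly p k)"
  by (induction p) auto

lemma ev_dvd: "p dvd q \<Longrightarrow> ev p x = 0 \<Longrightarrow> ev q x = 0"
  by (auto elim!: dvdE)

lemma ev_altdef: "degree p < n \<Longrightarrow> ev p x = (\<Sum>i<n. to_ac (poly.coeff p i) * x ^ i)"
proof -
  assume "degree p < n"
  then have "(\<Sum>i<n. to_ac (poly.coeff p i) * x ^ i) = (\<Sum>i\<le>degree p. to_ac (poly.coeff p i) * x ^ i)"
    by (intro sum.mono_neutral_right) (auto simp: coeff_eq_0)
  then show ?thesis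
    by (simp add: ev_def poly_altdef degree_map_poly coeff_map_poly)
qed

section \<open>Minimal polynomials\<close>

text \<open>\<open>min_poly\<close> is a definite description. Existence comes from normalising an
  annihilating polynomial of least degree; uniqueness holds because the difference of two monic
  candidates of that degree has smaller degree.\<close>

lemma min_poly_spec:
  "lead_coeff (min_poly x) = 1" "ev (min_poly x) x = 0"
  "q \<noteq> 0 \<Longrightarrow> ev q x = 0 \<Longrightarrow> degree (min_poly x) \<le> degree q"
proof -
  define A where "A p \<longleftrightarrow> p \<noteq> 0 \<and> ev p x = 0" for p
  define B where "B p \<longleftrightarrow> lead_coeff p = 1 \<and> ev p x = 0 \<and>
     (\<forall>q. q \<noteq> 0 \<and> ev q x = 0 \<longrightarrow> degree p \<le> degree q)" for p
  obtain p0 where p0: "A p0"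
    using alg_closure_algebraic[of x] unfolding A_def ev_def by metis
  define p1 where "p1 = arg_min degree A"
  have p1: "A p1" "\<And>q. A q \<Longrightarrow> degree p1 \<le> degree q"
    using arg_min_nat_lemma[of A p0 degree] p0 by (auto simp: p1_def)
  define p where "p = smult (inverse (lead_coeff p1)) p1"
  have "B p"
    using p1 by (auto simp: A_def B_def p_def)
  moreover have "p' = p" if "B p'" for p'
  proof (rule ccontr)
    assume "p' \<noteq> p"
    have deg: "degree p' = degree p"
      using that \<open>B p\<close> unfolding B_def by (metis le_antisym lead_coeff_1 leading_coeff_0_iff zero_neq_one)
    from \<open>p' \<noteq> p\<close> have "degree p \<le> degree (p' - p)"
      using that \<open>B p\<close> by (auto simp: B_def)
    moreover have "degree (p' - p) \<le> degree p"
      using degree_diff_le[of p' "degree p" p] deg by simp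
    moreover have "poly.coeff (p' - p) (degree p) = 0"
      using that \<open>B p\<close> deg by (simp add: B_def)
    ultimately show False
      using \<open>p' \<noteq> p\<close> by (metis eq_iff_diff_eq_0 le_antisym leading_coeff_0_iff)
  qed
  ultimately have "B (THE p. B p)"
    by (metis theI)
  then have "B (min_poly x)"
    by (simp add: B_def[abs_def] min_poly_def ev_def)
  then show "lead_coeff (min_poly x) = 1" "ev (min_poly x) x = 0"
    "q \<noteq> 0 \<Longrightarrow> ev q x = 0 \<Longrightarrow> degree (min_poly x) \<le> degree q"
    by (auto simp: B_def)
qed

lemma min_poly_nonzero [simp]: "min_poly x \<noteq> 0"
  using min_poly_spec(1)[of x] by auto

lemma min_poly_dvd_iff: "min_poly x dvd q \<longleftrightarrow> ev q x = 0"
proof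
  assume "ev q x = 0"
  have "q = min_poly x * (q div min_poly x) + q mod min_poly x"
    by simp
  then have "ev q x = ev (min_poly x) x * ev (q div min_poly x) x + ev (q mod min_poly x) x"
    by (metis ev_add ev_mult)
  then have *: "ev (q mod min_poly x) x = 0"
    using \<open>ev q x = 0\<close> min_poly_spec(2)[of x] by simp
  show "min_poly x dvd q"
  proof (rule ccontr)
    assume "\<not> min_poly x dvd q"
    then have "q mod min_poly x \<noteq> 0"
      by (simp add: dvd_eq_mod_eq_0)
    with min_poly_spec(3)[OF this *] degree_mod_less[of "min_poly x" q] show False
      by auto
  qed
qed (use ev_dvd min_poly_spec(2) in blast)

lemma degree_min_poly_pos: "degree (min_poly x) > 0"
proof (rule ccontr)
  assume "\<not> degree (min_poly x) > 0"
  then obtain c where "min_poly x = [:c:]"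
    using degree_eq_zeroE by auto
  with min_poly_spec(1,2)[of x] show False
    by auto
qed

lemma irreducible_min_poly: "irreducible (min_poly x)"
proof (rule irreducibleI)
  show "\<not> is_unit (min_poly x)"
    using degree_min_poly_pos[of x] by (auto simp: is_unit_iff_degree)
  fix a b assume ab: "min_poly x = a * b"
  then have nz: "a \<noteq> 0" "b \<noteq> 0"
    using min_poly_nonzero[of x] by auto
  have deg: "degree (min_poly x) = degree a + degree b"
    using ab nz by (simp add: degree_mult_eq)
  have "ev a x = 0 \<or> ev b x = 0"
    using min_poly_spec(2)[of x] ab by simp
  then show "is_unit a \<or> is_unit b"
    using nz deg min_poly_spec(3)[of a x] min_poly_spec(3)[of b x]
    by (auto simp: is_unit_iff_degree)
qed simp

lemma irreducible_dvd_min_poly: "irreducible p \<Longrightarrow> ev p x = 0 \<Longrightarrow> p dvd min_poly x"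
  by (metis irreducibleD' irreducible_min_poly irreducible_not_unit min_poly_dvd_iff)

text \<open>The two minimal polynomials divide each other. This carries relations and non-relations,
  such as a nonzero determinant, from \<alpha> to its conjugates without any automorphism.\<close>

lemma ev_conjugate_iff:
  assumes "ev (min_poly x) y = 0"
  shows "ev q y = 0 \<longleftrightarrow> ev q x = 0"
proof -
  have "min_poly x dvd min_poly y"
    using assms irreducible_min_poly irreducible_dvd_min_poly by blast
  moreover have "min_poly y dvd min_poly x"
    using assms min_poly_dvd_iff by blast
  ultimately show ?thesis
    by (metis dvd_trans min_poly_dvd_iff)
qed

lemma ev_conjugate_cong:
  assumes "ev (min_poly x) y = 0" "ev p x = ev q x"
  shows "ev p y = ev q y"
  using ev_conjugate_iff[OF assms(1), of "p - q"] assms(2) by simp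

text \<open>Solve the minimal equation for its constant term, which is nonzero by minimality unless
  \<open>x = 0\<close>. Rings containing the base field are therefore closed under
  inversion.\<close>

lemma inverse_eq_ev: "\<exists>p. inverse x = ev p x"
proof (cases "x = 0")
  case False
  obtain a q where aq: "min_poly x = pCons a q"
    by (meson pCons_cases)
  have "a \<noteq> 0"
  proof
    assume "a = 0"
    then have "ev q x = 0"
      using min_poly_spec(2)[of x] aq False by simp
    moreover have "q \<noteq> 0"
      using aq \<open>a = 0\<close> min_poly_nonzero[of x] by auto
    ultimately show False
      using min_poly_spec(3)[of q x] aq by (simp split: if_splits)
  qed
  have "to_ac a + x * ev q x = 0"
    using min_poly_spec(2)[of x] aq by simp
  then have "inverse x = ev (smult (- inverse a) q) x"
    using False \<open>a \<noteq> 0\<close> by (simp add: field_simps add_eq_0_iff)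
  then show ?thesis ..
qed (auto intro: exI[of _ 0])

section \<open>Separability in characteristic zero\<close>

lemma pderiv_map_poly_to_ac: "pderiv (map_poly to_ac p) = map_poly to_ac (pderiv p)"
  by (intro poly_eqI) (simp add: coeff_pderiv coeff_map_poly flip: of_nat_Suc)

text \<open>In characteristic zero the derivative of the minimal polynomial is nonzero and of
  smaller degree, so it does not vanish at \<open>x\<close>, hence at no conjugate: all roots are
  simple.\<close>

lemma card_conjugates:
  fixes x :: "'k::field_char_0 alg_closure"
  shows "card {y. ev (min_poly x) y = 0} = degree (min_poly x)"
proof -
  define p where "p = map_poly to_ac (min_poly x)"
  have p0: "p \<noteq> 0" and deg: "degree p = degree (min_poly x)" and lc: "lead_coeff p = 1"
    using min_poly_spec(1)[of x]
    by (auto simp: p_def map_poly_eq_0_iff degree_map_poly coeff_map_poly)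
  have simple: "poly (pderiv p) y \<noteq> 0" if "poly p y = 0" for y
  proof
    assume "poly (pderiv p) y = 0"
    then have "ev (pderiv (min_poly x)) y = 0"
      by (simp add: p_def ev_def pderiv_map_poly_to_ac)
    moreover have "ev (min_poly x) y = 0"
      using that by (simp add: p_def ev_def)
    ultimately have "ev (pderiv (min_poly x)) x = 0"
      using ev_conjugate_iff by blast
    then show False
      using min_poly_spec(3)[of "pderiv (min_poly x)" x] degree_min_poly_pos[of x]
      by (simp add: degree_pderiv pderiv_eq_0_iff)
  qed
  obtain A where A: "size A = degree p" "p = (\<Prod>y\<in>#A. [:-y, 1:])"
    using alg_closed_imp_factorization[OF p0] lc by auto
  have roots: "{y. ev (min_poly x) y = 0} = set_mset A"
  proof -
    have "ev (min_poly x) y = 0 \<longleftrightarrow> poly (\<Prod>y\<in>#A. [:-y, 1:]) y = 0" for y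
      by (simp add: ev_def flip: p_def A(2))
    moreover have "poly (\<Prod>y\<in>#A. [:-y, 1:]) y = 0 \<longleftrightarrow> y \<in># A" for y
      by (induction A) auto
    ultimately show ?thesis by auto
  qed
  have "count A y \<le> 1" for y
  proof (rule ccontr)
    assume "\<not> count A y \<le> 1"
    then have "{#y, y#} \<subseteq># A"
      by (auto simp: subseteq_mset_def)
    then obtain B where B: "A = {#y, y#} + B"
      by (auto simp: mset_subset_eq_exists_conv)
    then have "p = [:-y, 1:] * ([:-y, 1:] * (\<Prod>y\<in>#B. [:-y, 1:]))"
      by (simp add: A(2))
    then have "poly p y = 0" "poly (pderiv p) y = 0"
      by (auto simp: pderiv_mult simp del: mult_pCons_left)
    with simple show False by blast
  qed
  then have "size A = card (set_mset A)"
    by (metis count_greater_zero_iff le_antisym less_eq_Suc_le One_nat_def card_eq_sum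
        size_multiset_overloaded_eq sum.cong)
  then show ?thesis
    using roots A(1) deg by simp
qed

section \<open>Simple extensions\<close>

lemma ring_of_type_algebra_simps [simp]:
  "carrier ring_of_type_algebra = UNIV"
  "\<one>\<^bsub>ring_of_type_algebra\<^esub> = 1" "\<zero>\<^bsub>ring_of_type_algebra\<^esub> = 0"
  "x \<oplus>\<^bsub>ring_of_type_algebra\<^esub> y = x + y"
  "x \<otimes>\<^bsub>ring_of_type_algebra\<^esub> y = x * y"
  by (simp_all add: ring_of_type_algebra_def)

lemma a_inv_ring_of_type_algebra [simp]:
  "\<ominus>\<^bsub>ring_of_type_algebra\<^esub> x = - (x :: 'a::field)"
proof -
  interpret field "ring_of_type_algebra :: 'a ring" ..
  show ?thesis
    by (rule sym, rule sum_zero_eq_neg) auto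
qed

lemma m_inv_ring_of_type_algebra [simp]:
  "x \<noteq> 0 \<Longrightarrow> inv\<^bsub>ring_of_type_algebra\<^esub> x = inverse (x :: 'a::field)"
proof -
  assume "x \<noteq> 0"
  interpret field "ring_of_type_algebra :: 'a ring" ..
  show ?thesis
    by (rule comm_inv_char) (use \<open>x \<noteq> 0\<close> in auto)
qed

lemma ev_pcompose: "ev (pcompose p q) x = ev p (ev q x)"
  by (induction p) (simp_all add: pcompose_pCons)

lemma simple_ext_eq: "simple_ext \<alpha> = range (\<lambda>p. ev p \<alpha>)"
proof (intro equalityI subsetI)
  fix y assume "y \<in> simple_ext \<alpha>"
  then show "y \<in> range (\<lambda>p. ev p \<alpha>)"
    unfolding simple_ext_def
  proof (induction rule: generate_field.induct)
    case one
    then show ?case by (auto intro: image_eqI[of _ _ 1])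
  next
    case (incl h)
    then consider k where "h = to_ac k" | "h = \<alpha>" by auto
    then show ?case
    proof cases
      case 1
      then show ?thesis by (auto intro: image_eqI[of _ _ "[:k:]"])
    next
      case 2
      then show ?thesis by (auto intro: image_eqI[of _ _ "[:0, 1:]"])
    qed
  next
    case (a_inv h)
    then obtain p where "h = ev p \<alpha>" by auto
    then show ?case by (auto intro: image_eqI[of _ _ "- p"])
  next
    \<comment> \<open>The inverse of \<open>h\<close> is a polynomial in \<open>h\<close>, so
      composition makes it a polynomial in \<alpha>.\<close>
    case (m_inv h)
    then obtain p where "h = ev p \<alpha>" by auto
    moreover obtain q where "inverse h = ev q h"
      using inverse_eq_ev by blast
    ultimately show ?case
      using m_inv.hyps by (auto simp flip: ev_pcompose)
  next
    case (eng_add h1 h2)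
    then obtain p q where "h1 = ev p \<alpha>" "h2 = ev q \<alpha>" by auto
    then show ?case by (auto intro: image_eqI[of _ _ "p + q"])
  next
    case (eng_mult h1 h2)
    then obtain p q where "h1 = ev p \<alpha>" "h2 = ev q \<alpha>" by auto
    then show ?case by (auto intro: image_eqI[of _ _ "p * q"])
  qed
next
  let ?E = "simple_ext \<alpha>"
  have base: "to_ac k \<in> ?E" for k
    unfolding simple_ext_def by (auto intro: generate_field.incl)
  have gen: "\<alpha> \<in> ?E"
    unfolding simple_ext_def by (auto intro: generate_field.incl)
  have closed: "a + b \<in> ?E" "a * b \<in> ?E" if "a \<in> ?E" "b \<in> ?E" for a b
    using that generate_field.eng_add[of a ring_of_type_algebra _ b]
      generate_field.eng_mult[of a ring_of_type_algebra _ b]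
    by (auto simp: simple_ext_def)
  fix y assume "y \<in> range (\<lambda>p. ev p \<alpha>)"
  then obtain p where "y = ev p \<alpha>" by auto
  moreover have "ev p \<alpha> \<in> ?E"
    by (induction p) (use base[of 0] base gen closed in \<open>auto simp del: to_ac_0 simp: to_ac_0[symmetric]\<close>)
  ultimately show "y \<in> ?E" by simp
qed

lemma ext_degree_eq: "ext_degree \<alpha> = degree (min_poly \<alpha>)"
proof -
  define n where "n = degree (min_poly \<alpha>)"
  interpret vs: vector_space "\<lambda>k x. to_ac k * (x :: 'a alg_closure)"
    by unfold_locales (simp_all add: algebra_simps)
  define B where "B = (\<lambda>i. \<alpha> ^ i) ` {..<n}"
  have indep0: "c i = 0" if "(\<Sum>i<n. to_ac (c i) * \<alpha> ^ i) = 0" "i < n" for c i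
  proof (rule ccontr)
    assume "c i \<noteq> 0"
    define q where "q = (\<Sum>i<n. Polynomial.monom (c i) i)"
    have "ev q \<alpha> = 0"
      using that(1) by (simp add: q_def ev_sum)
    moreover have "poly.coeff q i = c i"
      using that(2) by (simp add: q_def coeff_sum)
    ultimately have "n \<le> degree q"
      using \<open>c i \<noteq> 0\<close> min_poly_spec(3)[of q \<alpha>] n_def by fastforce
    moreover have "degree q < n"
      unfolding q_def using that(2)
      by (intro degree_sum_less) (auto intro: le_less_trans[OF degree_monom_le])
    ultimately show False by simp
  qed
  \<comment> \<open>\<open>B\<close> is a set, so coinciding powers would lower its cardinality; a
    coincidence is itself a linear relation with coefficients 1 and -1.\<close>
  have inj: "inj_on (\<lambda>i. \<alpha> ^ i) {..<n}"
  proof (rule inj_onI, rule ccontr)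
    fix i j assume ij: "i \<in> {..<n}" "j \<in> {..<n}" "\<alpha> ^ i = \<alpha> ^ j" "i \<noteq> j"
    define c :: "nat \<Rightarrow> 'a" where "c = (\<lambda>k. (if k = i then 1 else 0) - (if k = j then 1 else 0))"
    have "(\<Sum>k<n. to_ac (c k) * \<alpha> ^ k)
        = (\<Sum>k<n. (if k = i then \<alpha> ^ k else 0) - (if k = j then \<alpha> ^ k else 0))"
      by (intro sum.cong) (auto simp: c_def)
    also have "\<dots> = 0"
      using ij by (simp add: sum_subtractf)
    finally show False
      using indep0[of c i] ij by (auto simp: c_def)
  qed
  have indep: "vs.independent B"
  proof
    assume "vs.dependent B"
    then obtain u where u: "\<exists>v\<in>B. u v \<noteq> 0" "(\<Sum>v\<in>B. to_ac (u v) * v) = 0"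
      using vs.dependent_finite[of B] by (auto simp: B_def)
    have "(\<Sum>i<n. to_ac (u (\<alpha> ^ i)) * \<alpha> ^ i) = 0"
      using u(2) inj by (simp add: B_def sum.reindex)
    from indep0[OF this] u(1) show False
      by (auto simp: B_def)
  qed
  have "simple_ext \<alpha> \<subseteq> vs.span B"
  proof
    fix y assume "y \<in> simple_ext \<alpha>"
    then obtain p where y: "y = ev p \<alpha>"
      by (auto simp: simple_ext_eq)
    define q where "q = p mod min_poly \<alpha>"
    have "p = min_poly \<alpha> * (p div min_poly \<alpha>) + q"
      by (simp add: q_def)
    then have "ev p \<alpha> = ev (min_poly \<alpha>) \<alpha> * ev (p div min_poly \<alpha>) \<alpha> + ev q \<alpha>"
      by (metis ev_add ev_mult)
    then have "y = ev q \<alpha>"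
      using y min_poly_spec(2)[of \<alpha>] by simp
    also have "degree q < n"
      unfolding q_def n_def using degree_min_poly_pos[of \<alpha>]
      by (metis degree_0 degree_mod_less min_poly_nonzero)
    then have "ev q \<alpha> = (\<Sum>i<n. to_ac (poly.coeff q i) * \<alpha> ^ i)"
      by (rule ev_altdef)
    also have "\<dots> \<in> vs.span B"
      by (intro vs.span_sum vs.span_scale vs.span_base) (auto simp: B_def)
    finally show "y \<in> vs.span B" .
  qed
  moreover have "B \<subseteq> simple_ext \<alpha>"
  proof
    fix y assume "y \<in> B"
    then obtain i where "y = \<alpha> ^ i" by (auto simp: B_def)
    then have "y = ev (Polynomial.monom 1 i) \<alpha>" by simp
    then show "y \<in> simple_ext \<alpha>" unfolding simple_ext_eq by blast
  qed
  ultimately have "card B = vs.dim (simple_ext \<alpha>)"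
    using indep by (intro vs.basis_card_eq_dim)
  moreover have "card B = n"
    using inj by (simp add: B_def card_image)
  ultimately show ?thesis
    by (simp add: ext_degree_def n_def)
qed

section \<open>Extending embeddings\<close>

text \<open>
  A homomorphism over the base field, defined on a subring, is represented by its graph; this
  makes unions of chains and one-step extensions easy to handle.
\<close>

definition partial_hom :: "('k::field alg_closure \<times> 'k alg_closure) set \<Rightarrow> bool" where
  "partial_hom G \<longleftrightarrow> (\<forall>k. (to_ac k, to_ac k) \<in> G) \<and>
     (\<forall>x y x' y'. (x, y) \<in> G \<longrightarrow> (x', y') \<in> G \<longrightarrow> (x + x', y + y') \<in> G \<and> (x * x', y * y') \<in> G) \<and>
     (\<forall>y. (0, y) \<in> G \<longrightarrow> y = 0)"

text \<open>Applies the homomorphism with graph \<open>G\<close> to all coefficients; as a relation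
  it needs no convention for coefficients outside the domain.\<close>

definition poly_rel :: "('a::zero \<times> 'b::zero) set \<Rightarrow> ('a poly \<times> 'b poly) set" where
  "poly_rel G = {(f, g). \<forall>i. (poly.coeff f i, poly.coeff g i) \<in> G}"

context
  fixes G :: "('k::field alg_closure \<times> 'k alg_closure) set"
  assumes G: "partial_hom G"
begin

lemma partial_hom_to_ac: "(to_ac k, to_ac k) \<in> G"
  and partial_hom_add: "(x, y) \<in> G \<Longrightarrow> (x', y') \<in> G \<Longrightarrow> (x + x', y + y') \<in> G"
  and partial_hom_mult: "(x, y) \<in> G \<Longrightarrow> (x', y') \<in> G \<Longrightarrow> (x * x', y * y') \<in> G"
  and partial_hom_zero: "(0, y) \<in> G \<Longrightarrow> y = 0"
  using G by (auto simp: partial_hom_def)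

lemma partial_hom_0: "(0, 0) \<in> G"
  using partial_hom_to_ac[of 0] by simp

lemma partial_hom_diff: "(x, y) \<in> G \<Longrightarrow> (x', y') \<in> G \<Longrightarrow> (x - x', y - y') \<in> G"
  using partial_hom_add[OF _ partial_hom_mult[OF partial_hom_to_ac[of "-1"]], of x y x' y'] by simp

text \<open>Single-valuedness is demanded only at 0; differences carry it to every argument.\<close>

lemma partial_hom_unique: "(x, y) \<in> G \<Longrightarrow> (x, y') \<in> G \<Longrightarrow> y = y'"
  using partial_hom_diff[of x y x y'] partial_hom_zero[of "y - y'"] by simp

lemma partial_hom_sum:
  "(\<And>i. i \<in> A \<Longrightarrow> (f i, g i) \<in> G) \<Longrightarrow> (sum f A, sum g A) \<in> G"
  by (induction A rule: infinite_finite_induct) (auto simp: partial_hom_0 partial_hom_add)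

lemma partial_hom_ev: "(x, y) \<in> G \<Longrightarrow> (ev p x, ev p y) \<in> G"
  by (induction p) (auto intro: partial_hom_0 partial_hom_add partial_hom_mult partial_hom_to_ac)

lemma partial_hom_inverse: "(x, y) \<in> G \<Longrightarrow> (inverse x, inverse y) \<in> G"
proof (cases "x = 0")
  case True
  assume "(x, y) \<in> G"
  with True have "y = 0" using partial_hom_zero by blast
  with True show ?thesis by (simp add: partial_hom_0)
next
  case False
  assume xy: "(x, y) \<in> G"
  obtain p where p: "inverse x = ev p x"
    using inverse_eq_ev by blast
  have *: "(inverse x, ev p y) \<in> G"
    using partial_hom_ev[OF xy, of p] p by simp
  then have "(1, y * ev p y) \<in> G"
    using partial_hom_mult[OF xy *] False by simp
  then have "y * ev p y = 1"
    using partial_hom_to_ac[of 1] partial_hom_unique by fastforce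
  then have "ev p y = inverse y"
    by (metis inverse_unique)
  with * show ?thesis by simp
qed

lemma poly_rel_zero: "(0, g) \<in> poly_rel G \<Longrightarrow> g = 0"
  by (auto simp: poly_rel_def intro!: poly_eqI partial_hom_zero)

lemma poly_rel_add: "(f, g) \<in> poly_rel G \<Longrightarrow> (f', g') \<in> poly_rel G \<Longrightarrow> (f + f', g + g') \<in> poly_rel G"
  by (auto simp: poly_rel_def intro: partial_hom_add)

lemma poly_rel_diff: "(f, g) \<in> poly_rel G \<Longrightarrow> (f', g') \<in> poly_rel G \<Longrightarrow> (f - f', g - g') \<in> poly_rel G"
  by (auto simp: poly_rel_def intro: partial_hom_diff)

lemma poly_rel_mult: "(f, g) \<in> poly_rel G \<Longrightarrow> (f', g') \<in> poly_rel G \<Longrightarrow> (f * f', g * g') \<in> poly_rel G"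
  by (auto simp: poly_rel_def coeff_mult intro!: partial_hom_sum partial_hom_mult)

lemma poly_rel_monom: "(a, b) \<in> G \<Longrightarrow> (Polynomial.monom a i, Polynomial.monom b i) \<in> poly_rel G"
  by (auto simp: poly_rel_def partial_hom_0)

text \<open>Let \<open>f0\<close> be the minimal polynomial of \<open>x\<close> over the domain of
  \<open>G\<close> and \<open>g0\<close> its image. Any root \<open>y\<close> of \<open>g0\<close>
  works: dividing by \<open>f0\<close> and, in parallel, by \<open>g0\<close> reduces every related
  pair to zero.\<close>

lemma partial_hom_target_exists:
  obtains y where "\<And>f g. (f, g) \<in> poly_rel G \<Longrightarrow> poly f x = 0 \<Longrightarrow> poly g y = 0"
proof -
  define I where "I f \<longleftrightarrow> f \<noteq> 0 \<and> poly f x = 0 \<and> (\<exists>g. (f, g) \<in> poly_rel G)" for f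
  obtain p where p: "p \<noteq> 0" "poly (map_poly to_ac p) x = 0"
    using alg_closure_algebraic[of x] by blast
  have "I (map_poly to_ac p)"
    unfolding I_def using p
    by (auto simp: map_poly_eq_0_iff poly_rel_def coeff_map_poly
        intro!: exI[of _ "map_poly to_ac p"] partial_hom_to_ac)
  then have min: "I (arg_min degree I)" "\<And>f. I f \<Longrightarrow> degree (arg_min degree I) \<le> degree f"
    using arg_min_nat_lemma[of I _ degree] by blast+
  define f1 where "f1 = arg_min degree I"
  obtain g1 where g1: "(f1, g1) \<in> poly_rel G"
    using min(1) by (auto simp: I_def f1_def)
  have f1: "f1 \<noteq> 0" "poly f1 x = 0"
    using min(1) by (auto simp: I_def f1_def)
  define d where "d = degree f1"
  define a where "a = inverse (lead_coeff f1)"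
  define b where "b = inverse (poly.coeff g1 d)"
  have ab: "(a, b) \<in> G"
    using g1 unfolding a_def b_def d_def by (auto simp: poly_rel_def intro!: partial_hom_inverse)
  define f0 g0 where "f0 = Polynomial.monom a 0 * f1" and "g0 = Polynomial.monom b 0 * g1"
  have fg0: "(f0, g0) \<in> poly_rel G"
    unfolding f0_def g0_def by (intro poly_rel_mult poly_rel_monom ab g1)
  have f0: "poly f0 x = 0" "poly.coeff f0 d = 1" "degree f0 = d"
    using f1 by (auto simp: f0_def a_def d_def monom_0)
  have "d > 0"
  proof (rule ccontr)
    assume "\<not> d > 0"
    then show False
      using f1 by (auto simp: d_def elim!: degree_eq_zeroE)
  qed
  \<comment> \<open>The image keeps the leading coefficient 1, so \<open>g0\<close> is not constant
    and has a root.\<close>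
  have g0: "poly.coeff g0 d = 1"
  proof -
    have "(1, poly.coeff g0 d) \<in> G"
      using fg0 f0(2) by (metis (mono_tags, lifting) case_prodD mem_Collect_eq poly_rel_def)
    then show ?thesis
      using partial_hom_to_ac[of 1] partial_hom_unique by fastforce
  qed
  then have "degree g0 > 0"
    using \<open>d > 0\<close> le_degree[of g0 d] by auto
  then obtain y where y: "poly g0 y = 0"
    using alg_closed_imp_poly_has_root by blast
  have "poly g y = 0" if "(f, g) \<in> poly_rel G" "poly f x = 0" for f g
    using that
  proof (induction "degree f" arbitrary: f g rule: less_induct)
    case less
    show ?case
    proof (cases "f = 0")
      case True
      then have "g = 0" using less.prems(1) poly_rel_zero by blast
      then show ?thesis by simp
    next
      case False
      define c c' where "c = lead_coeff f" and "c' = poly.coeff g (degree f)"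
      have cc: "(c, c') \<in> G"
        using less.prems(1) by (auto simp: poly_rel_def c_def c'_def)
      have "I f"
        using less.prems False by (auto simp: I_def)
      then have le: "d \<le> degree f"
        using min(2) by (simp add: d_def f1_def)
      \<comment> \<open>One step of polynomial division, on both components: \<open>h\<close>
        cancels the leading term of \<open>f\<close>, and its image \<open>h'\<close> vanishes at
        \<open>y\<close>.\<close>
      define k where "k = degree f - d"
      define h h' where "h = Polynomial.monom c k * f0" and "h' = Polynomial.monom c' k * g0"
      have hh: "(h, h') \<in> poly_rel G"
        unfolding h_def h'_def by (intro poly_rel_mult poly_rel_monom cc fg0)
      have red: "(f - h, g - h') \<in> poly_rel G" "poly (f - h) x = 0"
        using poly_rel_diff[OF less.prems(1) hh] less.prems(2) f0 by (auto simp: h_def)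
      have "poly (g - h') y = 0"
      proof (cases "f - h = 0")
        case True
        then have "g - h' = 0" using red(1) poly_rel_zero by metis
        then show ?thesis by simp
      next
        case False
        have "c \<noteq> 0" using \<open>f \<noteq> 0\<close> by (simp add: c_def)
        then have "h \<noteq> 0" "degree h = k + d"
          using f0 f1 by (auto simp: h_def degree_mult_eq degree_monom_eq a_def f0_def monom_0)
        then have "degree h = degree f"
          using le by (simp add: k_def)
        moreover have "poly.coeff h (degree f) = c"
          using f0(2) le by (simp add: h_def coeff_monom_mult k_def)
        ultimately have "poly.coeff (f - h) (degree f) = 0" "degree (f - h) \<le> degree f"
          by (auto simp: c_def intro: degree_diff_le)
        then have "degree (f - h) < degree f"
          using False by (metis le_neq_implies_less leading_coeff_0_iff)
        then show ?thesis
          using less.hyps red by blast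
      qed
      then show ?thesis
        using y by (simp add: h'_def)
    qed
  qed
  then show ?thesis using that by blast
qed

text \<open>The enlarged graph pairs values at \<open>x\<close> with values at \<open>y\<close>; the
  choice of \<open>y\<close> is exactly the zero clause of \<open>partial_hom\<close>.\<close>

lemma partial_hom_extend:
  obtains G' y where "partial_hom G'" "G \<subseteq> G'" "(x, y) \<in> G'"
proof -
  obtain y where y: "\<And>f g. (f, g) \<in> poly_rel G \<Longrightarrow> poly f x = 0 \<Longrightarrow> poly g y = 0"
    using partial_hom_target_exists by blast
  define G' where "G' = {(poly f x, poly g y) | f g. (f, g) \<in> poly_rel G}"
  have const: "(a, b) \<in> G'" if "(a, b) \<in> G" for a b
    using poly_rel_monom[OF that, of 0] unfolding G'_def by (force simp: monom_0)
  have "(Polynomial.monom 1 1, Polynomial.monom 1 1) \<in> poly_rel G"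
    using poly_rel_monom[OF partial_hom_to_ac[of 1], of 1] by simp
  then have "(x, y) \<in> G'"
    unfolding G'_def by (force simp: poly_monom)
  moreover have "partial_hom G'"
    unfolding partial_hom_def
  proof (intro conjI allI impI)
    show "(to_ac k, to_ac k) \<in> G'" for k
      by (intro const partial_hom_to_ac)
    show "b = 0" if "(0, b) \<in> G'" for b
      using that y by (auto simp: G'_def)
    fix a b a' b' assume "(a, b) \<in> G'" "(a', b') \<in> G'"
    then obtain f g f' g' where *: "(f, g) \<in> poly_rel G" "(f', g') \<in> poly_rel G"
      "a = poly f x" "b = poly g y" "a' = poly f' x" "b' = poly g' y"
      by (auto simp: G'_def)
    show "(a + a', b + b') \<in> G'"
      using poly_rel_add[OF *(1,2)] unfolding G'_def * poly_add[symmetric] by blast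
    show "(a * a', b * b') \<in> G'"
      using poly_rel_mult[OF *(1,2)] unfolding G'_def * poly_mult[symmetric] by blast
  qed
  ultimately show ?thesis
    using const by (intro that[of G' y]) auto
qed

end

text \<open>Zorn's lemma on graphs ordered by inclusion: a maximal one is total, since any missing
  argument could be added by \<open>partial_hom_extend\<close>.\<close>

lemma partial_hom_total_extension:
  assumes "partial_hom G0"
  obtains \<sigma> :: "'k::field alg_closure \<Rightarrow> 'k alg_closure" where
    "\<And>x y. (x, y) \<in> G0 \<Longrightarrow> \<sigma> x = y" "\<And>k. \<sigma> (to_ac k) = to_ac k"
    "\<And>x y. \<sigma> (x + y) = \<sigma> x + \<sigma> y" "\<And>x y. \<sigma> (x * y) = \<sigma> x * \<sigma> y"
proof -
  define A where "A = {G. partial_hom G \<and> G0 \<subseteq> G}"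
  have "\<exists>M\<in>A. \<forall>H\<in>A. M \<subseteq> H \<longrightarrow> H = M"
  proof (rule subset_Zorn_nonempty)
    show "A \<noteq> {}" using assms by (auto simp: A_def)
    fix C assume C: "C \<noteq> {}" "subset.chain A C"
    then have CA: "partial_hom H" "G0 \<subseteq> H" if "H \<in> C" for H
      using that by (auto simp: subset_chain_def A_def)
    have "partial_hom (\<Union>C)"
      unfolding partial_hom_def
    proof (intro conjI allI impI)
      show "(to_ac k, to_ac k) \<in> (\<Union>C)" for k
        using C(1) CA(1) partial_hom_to_ac by blast
      show "y = 0" if "(0, y) \<in> (\<Union>C)" for y
        using that CA(1) partial_hom_zero by blast
      fix x y x' y' assume "(x, y) \<in> (\<Union>C)" "(x', y') \<in> (\<Union>C)"
      then obtain G G' where GG: "G \<in> C" "G' \<in> C" "(x, y) \<in> G" "(x', y') \<in> G'" by auto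
      then have "G \<subseteq> G' \<or> G' \<subseteq> G"
        using C(2) by (auto simp: subset_chain_def)
      then obtain H where "H \<in> C" "(x, y) \<in> H" "(x', y') \<in> H"
        using GG by auto
      moreover from this have "partial_hom H"
        using CA(1) by blast
      ultimately show "(x + x', y + y') \<in> (\<Union>C)" "(x * x', y * y') \<in> (\<Union>C)"
        using partial_hom_add partial_hom_mult by blast+
    qed
    moreover have "G0 \<subseteq> \<Union>C"
      using C(1) CA(2) by blast
    ultimately show "(\<Union>C) \<in> A" by (auto simp: A_def)
  qed
  then obtain M where M: "partial_hom M" "G0 \<subseteq> M" "\<And>H. partial_hom H \<Longrightarrow> M \<subseteq> H \<Longrightarrow> H = M"
    unfolding A_def by (metis (mono_tags, lifting) mem_Collect_eq subset_trans)
  have "\<exists>y. (x, y) \<in> M" for x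
    using partial_hom_extend[OF M(1), of x] M(3) by metis
  then obtain \<sigma> where \<sigma>: "\<And>x. (x, \<sigma> x) \<in> M"
    by metis
  have eq: "\<sigma> x = y" if "(x, y) \<in> M" for x y
    using partial_hom_unique[OF M(1) \<sigma> that] .
  show ?thesis
  proof (rule that)
    show "\<sigma> x = y" if "(x, y) \<in> G0" for x y
      using eq that M(2) by blast
    show "\<sigma> (to_ac k) = to_ac k" for k
      by (intro eq partial_hom_to_ac M)
    show "\<sigma> (x + y) = \<sigma> x + \<sigma> y" for x y
      by (intro eq partial_hom_add M \<sigma>)
    show "\<sigma> (x * y) = \<sigma> x * \<sigma> y" for x y
      by (intro eq partial_hom_mult M \<sigma>)
  qed
qed

text \<open>The starting graph is the embedding of \<open>simple_ext \<alpha>\<close> sending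
  \<alpha> to \<beta>; its zero clause holds because conjugates satisfy the same relations.\<close>

lemma conjugation_extends:
  assumes "ev (min_poly \<alpha>) \<beta> = 0"
  obtains \<sigma> :: "'k::field alg_closure \<Rightarrow> 'k alg_closure" where
    "\<sigma> \<alpha> = \<beta>" "\<And>k. \<sigma> (to_ac k) = to_ac k"
    "\<And>x y. \<sigma> (x + y) = \<sigma> x + \<sigma> y" "\<And>x y. \<sigma> (x * y) = \<sigma> x * \<sigma> y"
proof -
  define G where "G = range (\<lambda>p. (ev p \<alpha>, ev p \<beta>))"
  have mem: "(ev p \<alpha>, ev p \<beta>) \<in> G" for p
    by (auto simp: G_def)
  have "partial_hom G"
    unfolding partial_hom_def
  proof (intro conjI allI impI)
    show "(to_ac k, to_ac k) \<in> G" for k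
      using mem[of "[:k:]"] by simp
    show "y = 0" if y: "(0, y) \<in> G" for y
    proof -
      obtain p where "(0, y) = (ev p \<alpha>, ev p \<beta>)"
        using y unfolding G_def by (rule rangeE)
      then show ?thesis using ev_conjugate_iff[OF assms, of p] by simp
    qed
    fix x y x' y' assume "(x, y) \<in> G" "(x', y') \<in> G"
    then obtain p q where "x = ev p \<alpha>" "y = ev p \<beta>" "x' = ev q \<alpha>" "y' = ev q \<beta>"
      by (auto simp: G_def)
    then show "(x + x', y + y') \<in> G" "(x * x', y * y') \<in> G"
      using mem[of "p + q"] mem[of "p * q"] by auto
  qed
  moreover have "(\<alpha>, \<beta>) \<in> G"
    using mem[of "[:0, 1:]"] by simp
  ultimately show ?thesis
    using partial_hom_total_extension[of G] that by metis
qed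

section \<open>The normal closure\<close>

lemma normal_ext_closed:
  assumes "normal_ext N"
  shows "to_ac k \<in> N" "x \<in> N \<Longrightarrow> y \<in> N \<Longrightarrow> x + y \<in> N" "x \<in> N \<Longrightarrow> y \<in> N \<Longrightarrow> x * y \<in> N"
    "x \<in> N \<Longrightarrow> ev (min_poly x) y = 0 \<Longrightarrow> y \<in> N"
proof -
  have "subring N ring_of_type_algebra"
    using assms subfieldE(1) by (auto simp: normal_ext_def)
  then show "x \<in> N \<Longrightarrow> y \<in> N \<Longrightarrow> x + y \<in> N" "x \<in> N \<Longrightarrow> y \<in> N \<Longrightarrow> x * y \<in> N"
    using subringE(6,7)[of N ring_of_type_algebra x y] by auto
  show "to_ac k \<in> N"
    using assms by (auto simp: normal_ext_def)
  show "y \<in> N" if "x \<in> N" "ev (min_poly x) y = 0"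
    using assms that irreducible_min_poly[of x] min_poly_spec(2)[of x]
    unfolding normal_ext_def ev_def by blast
qed

lemma normal_closure_closed:
  shows "x \<in> E \<Longrightarrow> x \<in> normal_closure E" "to_ac k \<in> normal_closure E"
    "x \<in> normal_closure E \<Longrightarrow> y \<in> normal_closure E \<Longrightarrow> x + y \<in> normal_closure E"
    "x \<in> normal_closure E \<Longrightarrow> y \<in> normal_closure E \<Longrightarrow> x * y \<in> normal_closure E"
    "x \<in> normal_closure E \<Longrightarrow> ev (min_poly x) y = 0 \<Longrightarrow> y \<in> normal_closure E"
proof -
  show "x \<in> normal_closure E" if "x \<in> E"
    using that by (auto simp: normal_closure_def)
  show "to_ac k \<in> normal_closure E"
    unfolding normal_closure_def using normal_ext_closed(1) by blast
  show "x + y \<in> normal_closure E" if "x \<in> normal_closure E" "y \<in> normal_closure E"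
    using that normal_ext_closed(2)[of _ x y] unfolding normal_closure_def by blast
  show "x * y \<in> normal_closure E" if "x \<in> normal_closure E" "y \<in> normal_closure E"
    using that normal_ext_closed(3)[of _ x y] unfolding normal_closure_def by blast
  show "y \<in> normal_closure E" if "x \<in> normal_closure E" "ev (min_poly x) y = 0"
    using that normal_ext_closed(4)[of _ x y] unfolding normal_closure_def by blast
qed

text \<open>Relative to \<open>N\<close>, because an automorphism of the normal closure is additive
  and multiplicative only there; membership in \<open>N\<close> has to travel along with the
  induction.\<close>

lemma hom_ev:
  assumes "\<And>k. \<sigma> (to_ac k) = to_ac k" "x \<in> N"
    "\<And>x y. x \<in> N \<Longrightarrow> y \<in> N \<Longrightarrow> \<sigma> (x + y) = \<sigma> x + \<sigma> y \<and> \<sigma> (x * y) = \<sigma> x * \<sigma> y"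
    "\<And>k. to_ac k \<in> N"
    "\<And>x y. x \<in> N \<Longrightarrow> y \<in> N \<Longrightarrow> x + y \<in> N \<and> x * y \<in> N"
  shows "\<sigma> (ev p x) = ev p (\<sigma> x) \<and> ev p x \<in> N"
proof (induction p)
  case 0
  then show ?case using assms(1)[of 0] assms(4)[of 0] by simp
next
  case (pCons a p)
  then show ?case using assms by simp
qed

text \<open>Surjectivity on the normal closure: \<open>\<sigma>\<close> is injective and maps the
  finite root set of each minimal polynomial to itself, so it permutes it, and the closure contains
  these roots.\<close>

lemma base_automorphism_of_hom:
  fixes \<sigma> :: "'k::field alg_closure \<Rightarrow> 'k alg_closure"
  assumes k: "\<And>k. \<sigma> (to_ac k) = to_ac k"
    and add: "\<And>x y. \<sigma> (x + y) = \<sigma> x + \<sigma> y" and mult: "\<And>x y. \<sigma> (x * y) = \<sigma> x * \<sigma> y"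
  shows "is_base_automorphism (normal_closure E) \<sigma>"
proof -
  let ?N = "normal_closure E"
  have ev: "\<sigma> (ev p x) = ev p (\<sigma> x)" for p x
    using hom_ev[of \<sigma> x UNIV] k add mult by simp
  have inj: "inj \<sigma>"
  proof (rule injI)
    fix x y assume "\<sigma> x = \<sigma> y"
    then have 0: "\<sigma> (x - y) = 0"
      using add[of "x - y" y] by simp
    show "x = y"
    proof (rule ccontr)
      assume "x \<noteq> y"
      then have "\<sigma> ((x - y) * inverse (x - y)) = 1"
        using k[of 1] by simp
      then show False using 0 mult by simp
    qed
  qed
  have conj: "ev (min_poly x) (\<sigma> y) = 0" if "ev (min_poly x) y = 0" for x y
    using ev[of "min_poly x" y] that k[of 0] by simp
  have maps: "\<sigma> x \<in> ?N" if "x \<in> ?N" for x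
    using that normal_closure_closed(5) conj min_poly_spec(2) by blast
  have "y \<in> \<sigma> ` ?N" if "y \<in> ?N" for y
  proof -
    define R where "R = {z. ev (min_poly y) z = 0}"
    have "finite R"
      unfolding R_def ev_def by (rule poly_roots_finite) (simp add: map_poly_eq_0_iff)
    moreover have "\<sigma> ` R \<subseteq> R"
      using conj by (auto simp: R_def)
    ultimately have "\<sigma> ` R = R"
      using inj by (metis endo_inj_surj inj_on_subset subset_UNIV)
    moreover have "y \<in> R" by (simp add: R_def min_poly_spec(2))
    moreover have "R \<subseteq> ?N"
      using that normal_closure_closed(5) by (auto simp: R_def)
    ultimately show ?thesis by blast
  qed
  then have "bij_betw \<sigma> ?N ?N"
    using maps inj by (auto simp: bij_betw_def inj_on_def)
  then show ?thesis
    using k add mult by (auto simp: is_base_automorphism_def)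
qed

section \<open>Multivariate polynomials and projective closures\<close>

lemma eval_mp_superset:
  assumes "finite A" "Poly_Mapping.keys p \<subseteq> A"
  shows "eval_mp p v = (\<Sum>m\<in>A. Poly_Mapping.lookup p m *
           (\<Prod>i\<in>Poly_Mapping.keys m. (v $ i) ^ Poly_Mapping.lookup m i))"
  unfolding eval_mp_def
  by (rule sum.mono_neutral_left) (use assms in \<open>auto simp: in_keys_iff\<close>)

lemma eval_mp_zero [simp]: "eval_mp 0 v = 0"
  by (simp add: eval_mp_def)

lemma eval_mp_add: "eval_mp (p + q) v = eval_mp p v + eval_mp q v"
proof -
  let ?A = "Poly_Mapping.keys p \<union> Poly_Mapping.keys q"
  have "Poly_Mapping.keys (p + q) \<subseteq> ?A"
    by (rule Poly_Mapping.keys_add)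
  then show ?thesis
    by (simp add: eval_mp_superset[of ?A] lookup_add algebra_simps sum.distrib)
qed

lemma eval_mp_sum: "eval_mp (sum f A) v = (\<Sum>x\<in>A. eval_mp (f x) v)"
  by (induction A rule: infinite_finite_induct) (auto simp: eval_mp_add)

lemma eval_mp_single:
  "eval_mp (Poly_Mapping.single m c) v =
     c * (\<Prod>i\<in>Poly_Mapping.keys m. (v $ i) ^ Poly_Mapping.lookup m i)"
  by (simp add: eval_mp_superset[of "{m}"])

lemma prod_keys_superset:
  fixes f :: "nat \<Rightarrow> 'a::comm_semiring_1"
  assumes "finite A" "Poly_Mapping.keys m \<subseteq> A"
  shows "(\<Prod>i\<in>Poly_Mapping.keys m. f i ^ Poly_Mapping.lookup m i) =
    (\<Prod>i\<in>A. f i ^ Poly_Mapping.lookup m i)"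
  by (rule prod.mono_neutral_left) (use assms in \<open>auto simp: in_keys_iff\<close>)

lemma multipolys_zero: "0 \<in> multipolys n"
  by (simp add: multipolys_def)

lemma multipolys_add: "p \<in> multipolys n \<Longrightarrow> q \<in> multipolys n \<Longrightarrow> p + q \<in> multipolys n"
  unfolding multipolys_def using Poly_Mapping.keys_add[of p q] by blast

lemma multipolys_sum: "(\<And>x. x \<in> A \<Longrightarrow> f x \<in> multipolys n) \<Longrightarrow> sum f A \<in> multipolys n"
  by (induction A rule: infinite_finite_induct) (auto simp: multipolys_zero multipolys_add)

lemma multipolys_single: "Poly_Mapping.keys m \<subseteq> {..<n} \<Longrightarrow> Poly_Mapping.single m c \<in> multipolys n"
  by (auto simp: multipolys_def split: if_splits)

definition exponent2 :: "nat \<Rightarrow> nat \<Rightarrow> nat \<Rightarrow>\<^sub>0 nat" where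
  "exponent2 i j = Poly_Mapping.single i 1 + Poly_Mapping.single j 1"

lemma exponent2:
  shows "Poly_Mapping.keys (exponent2 i j) \<subseteq> {i, j}"
    and "(\<Prod>k\<in>Poly_Mapping.keys (exponent2 i j). f k ^ Poly_Mapping.lookup (exponent2 i j) k) =
      f i * (f j :: 'a::comm_semiring_1)"
    and "(\<Sum>k\<in>Poly_Mapping.keys (exponent2 i j). Poly_Mapping.lookup (exponent2 i j) k) = 2"
proof -
  show *: "Poly_Mapping.keys (exponent2 i j) \<subseteq> {i, j}"
    unfolding exponent2_def using Poly_Mapping.keys_add by fastforce
  have "(\<Sum>k\<in>Poly_Mapping.keys (exponent2 i j). Poly_Mapping.lookup (exponent2 i j) k) =
      (\<Sum>k\<in>{i, j}. Poly_Mapping.lookup (exponent2 i j) k)"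
    by (rule sum.mono_neutral_left) (use * in \<open>auto simp: in_keys_iff\<close>)
  then show "(\<Sum>k\<in>Poly_Mapping.keys (exponent2 i j). Poly_Mapping.lookup (exponent2 i j) k) = 2"
    by (cases "i = j") (auto simp: exponent2_def lookup_add lookup_single)
  show "(\<Prod>k\<in>Poly_Mapping.keys (exponent2 i j). f k ^ Poly_Mapping.lookup (exponent2 i j) k) = f i * f j"
    unfolding prod_keys_superset[OF _ *, simplified]
    by (cases "i = j") (auto simp: exponent2_def lookup_add lookup_single power2_eq_square
        numeral_2_eq_2 mult.commute)
qed

text \<open>Summing over ordered pairs lets \<open>c\<close> be non-symmetric, so a product of two
  linear forms has the coefficients \<open>b i * c j\<close> directly.\<close>

lemma quadratic_form_multipoly:
  fixes c :: "nat \<Rightarrow> nat \<Rightarrow> 'a::comm_semiring_1"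
  obtains p where "p \<in> multipolys N" "homogeneous_mp p"
    "\<And>v. eval_mp p v = (\<Sum>i<N. \<Sum>j<N. c i j * (v $ i * v $ j))"
proof
  let ?p = "\<Sum>i<N. \<Sum>j<N. Poly_Mapping.single (exponent2 i j) (c i j)"
  show "?p \<in> multipolys N"
    by (intro multipolys_sum multipolys_single) (use exponent2(1) in fastforce)
  have "Poly_Mapping.keys ?p \<subseteq> {m. (\<Sum>k\<in>Poly_Mapping.keys m. Poly_Mapping.lookup m k) = 2}"
  proof -
    have "Poly_Mapping.keys ?p \<subseteq> (\<Union>i\<in>{..<N}. \<Union>j\<in>{..<N}. Poly_Mapping.keys (Poly_Mapping.single (exponent2 i j) (c i j)))"
      by (intro subset_trans[OF keys_sum] UN_mono order_refl)
    also have "\<dots> \<subseteq> {m. (\<Sum>k\<in>Poly_Mapping.keys m. Poly_Mapping.lookup m k) = 2}"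
      using exponent2(3) by (auto split: if_splits)
    finally show ?thesis .
  qed
  then show "homogeneous_mp ?p"
    unfolding homogeneous_mp_def by blast
  show "eval_mp ?p v = (\<Sum>i<N. \<Sum>j<N. c i j * (v $ i * v $ j))" for v
    by (simp add: eval_mp_sum eval_mp_single exponent2(2)[of "\<lambda>i. v $ i"])
qed

lemma linear_form_multipoly:
  fixes c :: "nat \<Rightarrow> 'a::comm_semiring_1"
  obtains p where "p \<in> multipolys N" "homogeneous_mp p" "\<And>v. eval_mp p v = (\<Sum>i<N. c i * v $ i)"
proof
  let ?p = "\<Sum>i<N. Poly_Mapping.single (Poly_Mapping.single i 1) (c i)"
  show "?p \<in> multipolys N"
    by (intro multipolys_sum multipolys_single) auto
  have "Poly_Mapping.keys ?p \<subseteq> {m. (\<Sum>k\<in>Poly_Mapping.keys m. Poly_Mapping.lookup m k) = 1}"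
    by (rule subset_trans[OF keys_sum]) (auto split: if_splits)
  then show "homogeneous_mp ?p"
    unfolding homogeneous_mp_def by blast
  show "eval_mp ?p v = (\<Sum>i<N. c i * v $ i)" for v
    by (simp add: eval_mp_sum eval_mp_single)
qed

lemma eval_mp_smult:
  fixes p :: "'a::comm_semiring_1 multipoly"
  assumes "p \<in> multipolys N" "homogeneous_mp p"
  obtains d where "\<And>c v. v \<in> carrier_vec N \<Longrightarrow> eval_mp p (c \<cdot>\<^sub>v v) = c ^ d * eval_mp p v"
proof -
  obtain d where d: "\<And>m. m \<in> Poly_Mapping.keys p \<Longrightarrow> (\<Sum>i\<in>Poly_Mapping.keys m. Poly_Mapping.lookup m i) = d"
    using assms(2) unfolding homogeneous_mp_def by blast
  show ?thesis
  proof
    fix c :: 'a and v :: "'a vec" assume v: "v \<in> carrier_vec N"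
    have "(\<Prod>i\<in>Poly_Mapping.keys m. ((c \<cdot>\<^sub>v v) $ i) ^ Poly_Mapping.lookup m i) =
        c ^ d * (\<Prod>i\<in>Poly_Mapping.keys m. (v $ i) ^ Poly_Mapping.lookup m i)"
      if m: "m \<in> Poly_Mapping.keys p" for m
    proof -
      have "Poly_Mapping.keys m \<subseteq> {..<N}"
        using assms(1) m by (auto simp: multipolys_def)
      then have "(\<Prod>i\<in>Poly_Mapping.keys m. ((c \<cdot>\<^sub>v v) $ i) ^ Poly_Mapping.lookup m i) =
          (\<Prod>i\<in>Poly_Mapping.keys m. c ^ Poly_Mapping.lookup m i * (v $ i) ^ Poly_Mapping.lookup m i)"
        using v by (intro prod.cong) (auto simp: power_mult_distrib)
      also have "\<dots> = c ^ d * (\<Prod>i\<in>Poly_Mapping.keys m. (v $ i) ^ Poly_Mapping.lookup m i)"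
        using d[OF m] by (simp add: prod.distrib flip: power_sum)
      finally show ?thesis .
    qed
    then show "eval_mp p (c \<cdot>\<^sub>v v) = c ^ d * eval_mp p v"
      unfolding eval_mp_def by (simp add: sum_distrib_left mult.left_commute)
  qed
qed

lemma eval_mp_path:
  fixes Y :: "nat \<Rightarrow> 'a::comm_semiring_1 poly"
  assumes "p \<in> multipolys N"
  obtains Q where "\<And>s. eval_mp p (vec N (\<lambda>i. poly (Y i) s)) = poly Q s"
proof
  fix s
  let ?Q = "\<Sum>m\<in>Poly_Mapping.keys p. [:Poly_Mapping.lookup p m:] *
    (\<Prod>i\<in>Poly_Mapping.keys m. Y i ^ Poly_Mapping.lookup m i)"
  have "(vec N (\<lambda>i. poly (Y i) s)) $ i = poly (Y i) s"
    if "m \<in> Poly_Mapping.keys p" "i \<in> Poly_Mapping.keys m" for m i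
  proof -
    have "i < N" using that assms by (auto simp: multipolys_def)
    then show ?thesis by simp
  qed
  then show "eval_mp p (vec N (\<lambda>i. poly (Y i) s)) = poly ?Q s"
    by (simp add: eval_mp_def poly_sum poly_prod)
qed

section \<open>Generic points\<close>

lemma base_expansion_unique:
  fixes a b :: "nat \<Rightarrow> nat"
  assumes "\<And>i. i < N \<Longrightarrow> a i < D" "\<And>i. i < N \<Longrightarrow> b i < D"
    "(\<Sum>i<N. a i * D ^ i) = (\<Sum>i<N. b i * D ^ i)" "i < N"
  shows "a i = b i"
  using assms
proof (induction N arbitrary: a b i)
  case (Suc N)
  have split: "(\<Sum>i<Suc N. a i * D ^ i) = a 0 + D * (\<Sum>i<N. a (Suc i) * D ^ i)" for a :: "nat \<Rightarrow> nat"
    by (simp only: sum.lessThan_Suc_shift) (simp add: sum_distrib_left algebra_simps)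
  have D: "a 0 < D" "b 0 < D" "D > 0"
    using Suc.prems(1,2)[of 0] by auto
  have eq: "a 0 + D * (\<Sum>i<N. a (Suc i) * D ^ i) = b 0 + D * (\<Sum>i<N. b (Suc i) * D ^ i)"
    using Suc.prems(3) unfolding split .
  have 0: "a 0 = b 0"
    using arg_cong[OF eq, of "\<lambda>x. x mod D"] D by simp
  then have eq': "(\<Sum>i<N. a (Suc i) * D ^ i) = (\<Sum>i<N. b (Suc i) * D ^ i)"
    using eq D by simp
  show ?case
  proof (cases i)
    case (Suc j)
    then show ?thesis
      using Suc.IH[of "\<lambda>i. a (Suc i)" "\<lambda>i. b (Suc i)" j] eq' Suc.prems(1,2,4) by simp
  qed (use 0 in simp)
qed simp

text \<open>Kronecker substitution \<open>X\<^sub>i \<mapsto> s ^ (D ^ i)\<close> reduces to univariate polynomials.\<close>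

lemma generic_point_exists:
  fixes G :: "'a::field_char_0 multipoly"
  assumes G: "G \<in> multipolys N" "G \<noteq> 0"
    and T: "finite T" "T \<subseteq> carrier_vec N" "0\<^sub>v N \<notin> T"
  obtains a where "a \<in> carrier_vec N" "eval_mp G a \<noteq> 0" "\<And>v. v \<in> T \<Longrightarrow> a \<bullet> v \<noteq> 0"
proof -
  let ?exps = "\<Union>m\<in>Poly_Mapping.keys G. (Poly_Mapping.lookup m) ` Poly_Mapping.keys m"
  \<comment> \<open>\<open>D\<close> exceeds every exponent in \<open>G\<close>, so distinct
    monomials become distinct powers of \<open>s\<close>. The inserted 1 gives
    \<open>D \<ge> 2\<close>, so the powers \<open>D ^ i\<close> differ too, which keeps the linear
    forms \<open>L v\<close> nonzero.\<close>
  define D where "D = Max (insert 1 ?exps) + 1"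
  have "D \<ge> 2"
    using Max_ge[of "insert 1 ?exps" 1] by (simp add: D_def)
  have bound: "Poly_Mapping.lookup m i < D" if "m \<in> Poly_Mapping.keys G" for m i
  proof (cases "i \<in> Poly_Mapping.keys m")
    case True
    then have "Poly_Mapping.lookup m i \<le> Max (insert 1 ?exps)"
      using that by (intro Max_ge) auto
    then show ?thesis by (simp add: D_def)
  next
    case False
    then show ?thesis using \<open>D \<ge> 2\<close> by (simp add: in_keys_iff)
  qed
  define e where "e m = (\<Sum>i<N. Poly_Mapping.lookup m i * D ^ i)" for m :: "nat \<Rightarrow>\<^sub>0 nat"
  have keys: "Poly_Mapping.keys m \<subseteq> {..<N}" if "m \<in> Poly_Mapping.keys G" for m
    using that G(1) by (auto simp: multipolys_def)
  have e_inj: "m = m'" if "m \<in> Poly_Mapping.keys G" "m' \<in> Poly_Mapping.keys G" "e m = e m'" for m m'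
  proof (rule poly_mapping_eqI)
    fix i
    show "Poly_Mapping.lookup m i = Poly_Mapping.lookup m' i"
    proof (cases "i < N")
      case True
      show ?thesis
        by (rule base_expansion_unique[of N _ D _ i])
          (use that bound True in \<open>auto simp: e_def\<close>)
    next
      case False
      then show ?thesis
        using keys that by (metis in_keys_iff lessThan_iff subsetD)
    qed
  qed
  define Q where "Q = (\<Sum>m\<in>Poly_Mapping.keys G. Polynomial.monom (Poly_Mapping.lookup G m) (e m))"
  define pt where "pt s = vec N (\<lambda>i. s ^ (D ^ i))" for s :: 'a
  have Q: "eval_mp G (pt s) = poly Q s" for s
  proof -
    have "(\<Prod>i\<in>Poly_Mapping.keys m. (pt s $ i) ^ Poly_Mapping.lookup m i) = s ^ e m"
      if "m \<in> Poly_Mapping.keys G" for m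
    proof -
      have "(\<Prod>i\<in>Poly_Mapping.keys m. (pt s $ i) ^ Poly_Mapping.lookup m i) =
          (\<Prod>i<N. (pt s $ i) ^ Poly_Mapping.lookup m i)"
        using keys[OF that] by (intro prod_keys_superset) auto
      also have "\<dots> = (\<Prod>i<N. s ^ (Poly_Mapping.lookup m i * D ^ i))"
        by (intro prod.cong) (simp_all add: pt_def mult.commute flip: power_mult)
      finally show ?thesis
        by (simp add: e_def power_sum)
    qed
    then show ?thesis
      by (simp add: eval_mp_def Q_def poly_sum poly_monom)
  qed
  obtain m0 where m0: "m0 \<in> Poly_Mapping.keys G"
    using G(2) by fastforce
  have "poly.coeff Q (e m0) = (\<Sum>m\<in>Poly_Mapping.keys G. if m = m0 then Poly_Mapping.lookup G m else 0)"
    unfolding Q_def coeff_sum using e_inj m0 by (intro sum.cong) auto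
  then have "poly.coeff Q (e m0) \<noteq> 0"
    using m0 by (simp add: in_keys_iff)
  then have "Q \<noteq> 0" by auto
  define L where "L v = (\<Sum>i<N. Polynomial.monom (v $ i) (D ^ i))" for v :: "'a vec"
  have L: "pt s \<bullet> v = poly (L v) s" if "v \<in> carrier_vec N" for s v
    using that by (simp add: scalar_prod_def pt_def L_def poly_sum poly_monom mult.commute atLeast0LessThan)
  have "L v \<noteq> 0" if "v \<in> T" for v
  proof -
    have v: "v \<in> carrier_vec N" "v \<noteq> 0\<^sub>v N" using that T by auto
    then obtain j where j: "j < N" "v $ j \<noteq> 0"
      by (metis carrier_vecD eq_vecI index_zero_vec)
    have "poly.coeff (L v) (D ^ j) = (\<Sum>i<N. if i = j then v $ i else 0)"
      unfolding L_def coeff_sum using \<open>D \<ge> 2\<close> by (intro sum.cong) auto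
    then have "poly.coeff (L v) (D ^ j) \<noteq> 0"
      using j by simp
    then show ?thesis by auto
  qed
  then have "Q * (\<Prod>v\<in>T. L v) \<noteq> 0"
    using \<open>Q \<noteq> 0\<close> T(1) by simp
  then have "finite {s. poly (Q * (\<Prod>v\<in>T. L v)) s = 0}"
    by (rule poly_roots_finite)
  then obtain s where "poly (Q * (\<Prod>v\<in>T. L v)) s \<noteq> 0"
    using infinite_UNIV_char_0[where 'a='a]
    by (metis (mono_tags, lifting) UNIV_eq_I mem_Collect_eq)
  then have "poly Q s \<noteq> 0" "\<And>v. v \<in> T \<Longrightarrow> poly (L v) s \<noteq> 0"
    using T(1) by (auto simp: poly_prod)
  moreover have "pt s \<in> carrier_vec N" by (simp add: pt_def)
  ultimately show ?thesis
    using that[of "pt s"] Q L T(2) by (metis subsetD)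
qed

section \<open>Projective closures of affine sets\<close>

text \<open>Erasing the exponent of the last variable substitutes 1 for it. Different monomials may
  merge, hence a sum of single terms.\<close>

lemma dehomogenize:
  fixes p :: "'a::field multipoly"
  assumes "p \<in> multipolys (n + 1)"
  obtains q where "q \<in> multipolys n" "\<And>x. eval_mp q x = eval_mp p (affine_embed n x)"
proof
  let ?r = "Poly_Mapping.update n 0 :: (nat \<Rightarrow>\<^sub>0 nat) \<Rightarrow> _"
  let ?q = "\<Sum>m\<in>Poly_Mapping.keys p. Poly_Mapping.single (?r m) (Poly_Mapping.lookup p m)"
  have keys: "Poly_Mapping.keys m \<subseteq> {..<n + 1}" if "m \<in> Poly_Mapping.keys p" for m
    using that assms by (auto simp: multipolys_def)
  show "?q \<in> multipolys n"
    by (intro multipolys_sum multipolys_single) (use keys in \<open>fastforce simp: keys_update\<close>)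
  show "eval_mp ?q x = eval_mp p (affine_embed n x)" for x
  proof -
    have "(\<Prod>i\<in>Poly_Mapping.keys (?r m). (x $ i) ^ Poly_Mapping.lookup (?r m) i) =
        (\<Prod>i\<in>Poly_Mapping.keys m. (affine_embed n x $ i) ^ Poly_Mapping.lookup m i)"
      if m: "m \<in> Poly_Mapping.keys p" for m
    proof -
      have "(\<Prod>i\<in>Poly_Mapping.keys (?r m). (x $ i) ^ Poly_Mapping.lookup (?r m) i) =
          (\<Prod>i<n + 1. (x $ i) ^ Poly_Mapping.lookup (?r m) i)"
        by (rule prod_keys_superset) (use keys[OF m] in \<open>auto simp: keys_update\<close>)
      also have "\<dots> = (\<Prod>i<n + 1. (affine_embed n x $ i) ^ Poly_Mapping.lookup m i)"
        by (intro prod.cong) (auto simp: affine_embed_def lookup_update)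
      also have "\<dots> = (\<Prod>i\<in>Poly_Mapping.keys m. (affine_embed n x $ i) ^ Poly_Mapping.lookup m i)"
        by (rule prod_keys_superset[symmetric]) (use keys[OF m] in auto)
      finally show ?thesis .
    qed
    then show ?thesis
      by (simp add: eval_mp_sum eval_mp_single) (simp add: eval_mp_def)
  qed
qed

text \<open>A polynomial in \<open>n + 1\<close> variables vanishing on the embedded
  \<open>S\<close> dehomogenises to one vanishing on \<open>S\<close>, hence on its Zariski closure.
  Everything below can thus work with the parametrised points alone.\<close>

lemma proj_closure_zariski_closure:
  assumes "S \<subseteq> carrier_vec n"
  shows "proj_closure n (zariski_closure n S) = proj_closure n S"
proof -
  have "(\<forall>x\<in>zariski_closure n S. eval_mp p (affine_embed n x) = 0) \<longleftrightarrow>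
      (\<forall>x\<in>S. eval_mp p (affine_embed n x) = 0)" if p: "p \<in> multipolys (n + 1)" for p
  proof -
    obtain q where "q \<in> multipolys n" and q: "\<And>x. eval_mp q x = eval_mp p (affine_embed n x)"
      using dehomogenize[OF p] by blast
    then show ?thesis
      using assms unfolding zariski_closure_def by (auto simp flip: q)
  qed
  then show ?thesis
    unfolding proj_closure_def by auto
qed

lemma proj_closure_quadratic:
  fixes c :: "nat \<Rightarrow> nat \<Rightarrow> 'a::field"
  assumes "P \<in> proj_closure n S" "v \<in> P"
    "\<And>x. x \<in> S \<Longrightarrow> (\<Sum>i<n + 1. \<Sum>j<n + 1. c i j * (affine_embed n x $ i * affine_embed n x $ j)) = 0"
  shows "(\<Sum>i<n + 1. \<Sum>j<n + 1. c i j * (v $ i * v $ j)) = 0"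
proof -
  obtain p where "p \<in> multipolys (n + 1)" "homogeneous_mp p"
    "\<And>v. eval_mp p v = (\<Sum>i<n + 1. \<Sum>j<n + 1. c i j * (v $ i * v $ j))"
    using quadratic_form_multipoly by blast
  then show ?thesis
    using assms by (auto simp: proj_closure_def)
qed

lemma proj_closure_linear:
  fixes c :: "nat \<Rightarrow> 'a::field"
  assumes "P \<in> proj_closure n S" "v \<in> P"
    "\<And>x. x \<in> S \<Longrightarrow> (\<Sum>i<n + 1. c i * affine_embed n x $ i) = 0"
  shows "(\<Sum>i<n + 1. c i * v $ i) = 0"
proof -
  obtain p where "p \<in> multipolys (n + 1)" "homogeneous_mp p"
    "\<And>v. eval_mp p v = (\<Sum>i<n + 1. c i * v $ i)"
    using linear_form_multipoly by blast
  then show ?thesis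
    using assms by (auto simp: proj_closure_def)
qed

text \<open>This produces limit points: \<open>s0\<close> may be one of the exceptional parameters
  in \<open>E\<close>, since a univariate polynomial with infinitely many roots is zero.\<close>

lemma proj_closure_path:
  fixes Y :: "nat \<Rightarrow> 'a::field_char_0 poly" and n :: nat
  defines "V s \<equiv> vec (n + 1) (\<lambda>i. poly (Y i) s)"
  assumes E: "finite E" and path: "\<And>s. s \<notin> E \<Longrightarrow> \<exists>x\<in>S. \<exists>c. V s = c \<cdot>\<^sub>v affine_embed n x"
    and nz: "V s0 \<noteq> 0\<^sub>v (n + 1)"
  shows "proj_point (V s0) \<in> proj_closure n S"
proof -
  have V: "V s \<in> carrier_vec (n + 1)" for s
    by (simp add: V_def)
  have "eval_mp p v = 0"
    if p: "p \<in> multipolys (n + 1)" "homogeneous_mp p" "\<forall>x\<in>S. eval_mp p (affine_embed n x) = 0"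
      and v: "v \<in> proj_point (V s0)" for p v
  proof -
    obtain d where d: "\<And>c v. v \<in> carrier_vec (n + 1) \<Longrightarrow> eval_mp p (c \<cdot>\<^sub>v v) = c ^ d * eval_mp p v"
      using eval_mp_smult[OF p(1,2)] by blast
    obtain Q where Q: "\<And>s. eval_mp p (V s) = poly Q s"
      using eval_mp_path[OF p(1)] unfolding V_def by blast
    have "poly Q s = 0" if "s \<notin> E" for s
    proof -
      obtain x c where "x \<in> S" "V s = c \<cdot>\<^sub>v affine_embed n x"
        using path[OF \<open>s \<notin> E\<close>] by blast
      then show ?thesis
        using p(3) d[of "affine_embed n x" c] by (simp add: affine_embed_def flip: Q)
    qed
    then have "UNIV - E \<subseteq> {s. poly Q s = 0}" by auto
    moreover have "infinite (UNIV - E)"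
      using E infinite_UNIV_char_0 by (rule Diff_infinite_finite)
    ultimately have "Q = 0"
      using poly_roots_finite finite_subset by blast
    then have "eval_mp p (V s0) = 0"
      by (simp add: Q)
    then show ?thesis
      using v d[OF V] by (auto simp: proj_point_def)
  qed
  then show ?thesis
    using nz V by (auto simp: proj_closure_def proj_space_def)
qed

lemma proj_point_smult:
  assumes "c \<noteq> (0::'a::field)"
  shows "proj_point (c \<cdot>\<^sub>v v) = proj_point v"
proof -
  have "\<exists>e. e \<noteq> 0 \<and> d \<cdot>\<^sub>v v = (e * c) \<cdot>\<^sub>v v" if "d \<noteq> 0" for d
    using that assms by (intro exI[of _ "d / c"]) simp
  then show ?thesis
    using assms by (fastforce simp: proj_point_def smult_smult_assoc)
qed

lemma proj_point_self: "v \<in> proj_point v"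
  by (auto simp: proj_point_def intro!: exI[of _ 1])

section \<open>Curves parametrized by partial fractions\<close>

text \<open>For \<open>R\<close> the set of conjugates of \<alpha> this is the minimal polynomial
  divided by \<open>t - \<beta>\<close>; up to a scalar it is the Lagrange basis polynomial at
  \<beta>.\<close>

definition cofactor :: "'a::field set \<Rightarrow> 'a \<Rightarrow> 'a poly" where
  "cofactor R \<beta> = (\<Prod>\<gamma>\<in>R - {\<beta>}. [:- \<gamma>, 1:])"

text \<open>
  The relation between the coordinates is \<open>z \<gamma> - z \<beta> = (\<delta> \<beta> - \<delta> \<gamma>) * z \<beta> * z \<gamma>\<close> for the normalised
  coordinates \<open>z \<beta> = (y \<beta> - A \<beta>) / B \<beta> = 1 / (s + \<delta> \<beta>)\<close>; the function \<open>zc\<close> below is their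
  homogeneous version.
\<close>

locale partial_fraction_curve =
  fixes n :: nat and R :: "'a::field_char_0 set" and A B \<delta> :: "'a \<Rightarrow> 'a" and S :: "'a vec set"
  assumes finite_R: "finite R" and card_R: "card R = n" and n_pos: "n > 0"
    and S: "S \<subseteq> carrier_vec n"
    and B: "\<beta> \<in> R \<Longrightarrow> B \<beta> \<noteq> 0"
    and S_relation: "x \<in> S \<Longrightarrow> \<beta> \<in> R \<Longrightarrow> \<gamma> \<in> R \<Longrightarrow>
      ((\<Sum>i<n. x $ i * \<gamma> ^ i) - A \<gamma>) / B \<gamma> - ((\<Sum>i<n. x $ i * \<beta> ^ i) - A \<beta>) / B \<beta> =
      (\<delta> \<beta> - \<delta> \<gamma>) * (((\<Sum>i<n. x $ i * \<beta> ^ i) - A \<beta>) / B \<beta>) * (((\<Sum>i<n. x $ i * \<gamma> ^ i) - A \<gamma>) / B \<gamma>)"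
    and S_points: "\<exists>E. finite E \<and> (\<forall>s. s \<notin> E \<longrightarrow> (\<exists>x\<in>S. \<forall>\<beta>\<in>R. s + \<delta> \<beta> \<noteq> 0 \<and>
      (\<Sum>i<n. x $ i * \<beta> ^ i) = A \<beta> + B \<beta> / (s + \<delta> \<beta>)))"
begin

section \<open>Lagrange interpolation on \<open>R\<close>\<close>

lemma cofactor_root: "\<beta> \<in> R \<Longrightarrow> \<gamma> \<in> R \<Longrightarrow> poly (cofactor R \<beta>) \<gamma> = 0 \<longleftrightarrow> \<gamma> \<noteq> \<beta>"
  using finite_R by (auto simp: cofactor_def poly_prod)

lemma degree_cofactor: "\<beta> \<in> R \<Longrightarrow> degree (cofactor R \<beta>) = n - 1"
  using finite_R card_R unfolding cofactor_def
  by (subst degree_prod_eq_sum_degree) auto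

lemma poly_eq_sum_lessThan: "degree (p :: 'a poly) < n \<Longrightarrow> poly p x = (\<Sum>i<n. poly.coeff p i * x ^ i)"
proof -
  assume "degree p < n"
  then have "(\<Sum>i<n. poly.coeff p i * x ^ i) = (\<Sum>i\<le>degree p. poly.coeff p i * x ^ i)"
    by (intro sum.mono_neutral_right) (auto simp: coeff_eq_0)
  then show ?thesis by (simp add: poly_altdef)
qed

text \<open>The entries of the inverse of the Vandermonde matrix with entries
  \<open>\<beta> ^ i\<close>.\<close>

definition lagrange :: "'a \<Rightarrow> nat \<Rightarrow> 'a" where
  "lagrange \<beta> i = poly.coeff (cofactor R \<beta>) i / poly (cofactor R \<beta>) \<beta>"

lemma sum_lagrange:
  assumes "\<beta> \<in> R" "\<gamma> \<in> R"
  shows "(\<Sum>i<n. lagrange \<beta> i * \<gamma> ^ i) = (if \<gamma> = \<beta> then 1 else 0)"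
proof -
  have "(\<Sum>i<n. lagrange \<beta> i * \<gamma> ^ i) = (\<Sum>i<n. poly.coeff (cofactor R \<beta>) i * \<gamma> ^ i) / poly (cofactor R \<beta>) \<beta>"
    by (simp add: lagrange_def sum_divide_distrib)
  also have "\<dots> = poly (cofactor R \<beta>) \<gamma> / poly (cofactor R \<beta>) \<beta>"
    using degree_cofactor[OF assms(1)] n_pos by (subst poly_eq_sum_lessThan) auto
  finally show ?thesis
    using cofactor_root[OF assms] cofactor_root[OF assms(1,1)] by auto
qed

definition y :: "'a \<Rightarrow> 'a vec \<Rightarrow> 'a" where
  "y \<beta> v = (\<Sum>i<n. v $ i * \<beta> ^ i)"

text \<open>The \<open>y \<beta> v\<close> are the values on \<open>R\<close> of the polynomial with
  coefficients \<open>v $ i\<close>; degree below \<open>n\<close> and agreement at \<open>n\<close>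
  points determine it.\<close>

lemma lagrange_interpolation:
  assumes "i < n"
  shows "v $ i = (\<Sum>\<beta>\<in>R. lagrange \<beta> i * y \<beta> v)"
proof -
  define p where "p = (\<Sum>j<n. Polynomial.monom (v $ j) j)"
  define q where "q = (\<Sum>j<n. Polynomial.monom (\<Sum>\<beta>\<in>R. lagrange \<beta> j * y \<beta> v) j)"
  have "p = q"
  proof (rule poly_eqI_degree)
    fix \<gamma> assume "\<gamma> \<in> R"
    have "poly q \<gamma> = (\<Sum>j<n. \<Sum>\<beta>\<in>R. lagrange \<beta> j * y \<beta> v * \<gamma> ^ j)"
      by (simp add: q_def poly_sum poly_monom sum_distrib_right)
    also have "\<dots> = (\<Sum>\<beta>\<in>R. (\<Sum>j<n. lagrange \<beta> j * \<gamma> ^ j) * y \<beta> v)"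
      by (subst sum.swap) (simp add: sum_distrib_left sum_distrib_right mult_ac)
    also have "\<dots> = (\<Sum>\<beta>\<in>R. if \<beta> = \<gamma> then y \<beta> v else 0)"
      using \<open>\<gamma> \<in> R\<close> by (intro sum.cong) (auto simp: sum_lagrange)
    also have "\<dots> = poly p \<gamma>"
      using \<open>\<gamma> \<in> R\<close> finite_R by (simp add: p_def poly_sum poly_monom y_def)
    finally show "poly p \<gamma> = poly q \<gamma>" ..
  next
    show "degree p < card R" "degree q < card R"
      unfolding p_def q_def card_R using n_pos
      by (auto intro!: degree_sum_less le_less_trans[OF degree_monom_le])
  qed
  then have "poly.coeff p i = poly.coeff q i" by simp
  then show ?thesis
    using assms by (simp add: p_def q_def coeff_sum)
qed

section \<open>Homogeneous coordinates adapted to the curve\<close>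

text \<open>The inverse of the coordinate change: the vector with last entry \<open>w\<close> and
  normalised coordinates \<open>Z \<beta>\<close>, so that poles and parameter infinity are easy to
  write down.\<close>

definition pt :: "'a \<Rightarrow> ('a \<Rightarrow> 'a) \<Rightarrow> 'a vec" where
  "pt w Z = vec (n + 1) (\<lambda>i. if i < n then \<Sum>\<beta>\<in>R. lagrange \<beta> i * (A \<beta> * w + B \<beta> * Z \<beta>) else w)"

definition zc :: "'a \<Rightarrow> 'a vec \<Rightarrow> 'a" where
  "zc \<beta> v = (y \<beta> v - A \<beta> * v $ n) / B \<beta>"

lemma pt_carrier [simp]: "pt w Z \<in> carrier_vec (n + 1)" "pt w Z \<in> carrier_vec (Suc n)"
  and pt_last [simp]: "pt w Z $ n = w"
  by (simp_all add: pt_def)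

lemma pt_zc: "v \<in> carrier_vec (n + 1) \<Longrightarrow> pt (v $ n) (\<lambda>\<beta>. zc \<beta> v) = v"
proof (rule eq_vecI)
  fix i assume "v \<in> carrier_vec (n + 1)" "i < dim_vec v"
  then have i: "i < n \<or> i = n" by auto
  have "(\<Sum>\<beta>\<in>R. lagrange \<beta> i * (A \<beta> * v $ n + B \<beta> * zc \<beta> v)) = (\<Sum>\<beta>\<in>R. lagrange \<beta> i * y \<beta> v)"
    using B by (intro sum.cong) (auto simp: zc_def)
  then show "pt (v $ n) (\<lambda>\<beta>. zc \<beta> v) $ i = v $ i"
    using i lagrange_interpolation[of i v] by (auto simp: pt_def)
qed (simp add: pt_def)

lemma y_pt:
  assumes "\<gamma> \<in> R"
  shows "y \<gamma> (pt w Z) = A \<gamma> * w + B \<gamma> * Z \<gamma>"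
proof -
  have "y \<gamma> (pt w Z) = (\<Sum>i<n. \<Sum>\<beta>\<in>R. lagrange \<beta> i * (A \<beta> * w + B \<beta> * Z \<beta>) * \<gamma> ^ i)"
    by (simp add: y_def pt_def sum_distrib_right)
  also have "\<dots> = (\<Sum>\<beta>\<in>R. (\<Sum>i<n. lagrange \<beta> i * \<gamma> ^ i) * (A \<beta> * w + B \<beta> * Z \<beta>))"
    by (subst sum.swap) (simp add: sum_distrib_left sum_distrib_right mult_ac)
  also have "\<dots> = (\<Sum>\<beta>\<in>R. if \<beta> = \<gamma> then A \<beta> * w + B \<beta> * Z \<beta> else 0)"
    using assms by (intro sum.cong) (auto simp: sum_lagrange)
  finally show ?thesis
    using assms finite_R by simp
qed

lemma zc_pt: "\<gamma> \<in> R \<Longrightarrow> zc \<gamma> (pt w Z) = Z \<gamma>"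
  by (simp add: zc_def y_pt B)

lemma pt_smult: "c \<cdot>\<^sub>v pt w Z = pt (c * w) (\<lambda>\<beta>. c * Z \<beta>)"
  by (rule eq_vecI) (auto simp: pt_def sum_distrib_left algebra_simps)

lemma pt_cong: "(\<And>\<beta>. \<beta> \<in> R \<Longrightarrow> Z \<beta> = Z' \<beta>) \<Longrightarrow> pt w Z = pt w Z'"
  by (rule eq_vecI) (auto simp: pt_def)

lemma pt_eq_0_iff: "pt w Z = 0\<^sub>v (n + 1) \<longleftrightarrow> w = 0 \<and> (\<forall>\<beta>\<in>R. Z \<beta> = 0)"
proof
  assume *: "pt w Z = 0\<^sub>v (n + 1)"
  then have "w = 0" using pt_last[of w Z] by (simp del: pt_last)
  moreover have "Z \<beta> = 0" if "\<beta> \<in> R" for \<beta>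
    using zc_pt[OF that, of w Z] * by (simp add: zc_def y_def)
  ultimately show "w = 0 \<and> (\<forall>\<beta>\<in>R. Z \<beta> = 0)" by blast
qed (auto simp: pt_def intro!: eq_vecI)

section \<open>Equations valid on the closure\<close>

lemma zc_linear_form:
  obtains c where "\<And>v. zc \<beta> v = (\<Sum>i<n + 1. c i * v $ i)"
proof
  show "zc \<beta> v = (\<Sum>i<n + 1. (if i < n then \<beta> ^ i / B \<beta> else - A \<beta> / B \<beta>) * v $ i)" for v
    by (simp add: zc_def y_def diff_divide_distrib sum_divide_distrib mult.commute)
qed

lemma y_affine_embed: "y \<beta> (affine_embed n x) = (\<Sum>i<n. x $ i * \<beta> ^ i)"
  by (simp add: y_def affine_embed_def)

lemma zc_affine_embed:
  "x \<in> S \<Longrightarrow> \<beta> \<in> R \<Longrightarrow> \<gamma> \<in> R \<Longrightarrow> zc \<gamma> (affine_embed n x) - zc \<beta> (affine_embed n x) =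
    (\<delta> \<beta> - \<delta> \<gamma>) * zc \<beta> (affine_embed n x) * zc \<gamma> (affine_embed n x)"
  using S_relation[of x \<beta> \<gamma>] by (simp add: zc_def y_affine_embed) (simp add: affine_embed_def)

text \<open>The last coordinate is 1 on the embedded curve, so a factor \<open>v $ n\<close> on the
  linear side makes the relation homogeneous of degree 2.\<close>

lemma closure_quadric:
  assumes P: "P \<in> proj_closure n S" "v \<in> P" and R: "\<beta> \<in> R" "\<gamma> \<in> R"
  shows "(zc \<gamma> v - zc \<beta> v) * v $ n = (\<delta> \<beta> - \<delta> \<gamma>) * zc \<beta> v * zc \<gamma> v"
proof -
  obtain b where b: "\<And>v. zc \<beta> v = (\<Sum>i<n + 1. b i * v $ i)"
    by (rule zc_linear_form[of \<beta>]) blast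
  obtain c where c: "\<And>v. zc \<gamma> v = (\<Sum>i<n + 1. c i * v $ i)"
    by (rule zc_linear_form[of \<gamma>]) blast
  \<comment> \<open>Coefficients of the quadric, with the last coordinate written as a linear form
    as well.\<close>
  define q where "q i j = (c i - b i) * (if j = n then 1 else 0) - (\<delta> \<beta> - \<delta> \<gamma>) * b i * c j" for i j
  have last: "v $ n = (\<Sum>j<n + 1. (if j = n then 1 else 0) * v $ j)" for v :: "'a vec"
    by simp
  have q: "(\<Sum>i<n + 1. \<Sum>j<n + 1. q i j * (v $ i * v $ j)) =
      (zc \<gamma> v - zc \<beta> v) * v $ n - (\<delta> \<beta> - \<delta> \<gamma>) * zc \<beta> v * zc \<gamma> v" for v
  proof -
    have "(zc \<gamma> v - zc \<beta> v) * v $ n =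
        (\<Sum>i<n + 1. (c i - b i) * v $ i) * (\<Sum>j<n + 1. (if j = n then 1 else 0) * v $ j)"
      unfolding last[symmetric] b c by (simp add: left_diff_distrib sum_subtractf)
    then have 1: "(zc \<gamma> v - zc \<beta> v) * v $ n =
        (\<Sum>i<n + 1. \<Sum>j<n + 1. ((c i - b i) * v $ i) * ((if j = n then 1 else 0) * v $ j))"
      unfolding sum_product .
    have "zc \<beta> v * zc \<gamma> v = (\<Sum>i<n + 1. \<Sum>j<n + 1. (b i * v $ i) * (c j * v $ j))"
      unfolding b c by (rule sum_product)
    then have 2: "(\<delta> \<beta> - \<delta> \<gamma>) * zc \<beta> v * zc \<gamma> v =
        (\<Sum>i<n + 1. \<Sum>j<n + 1. (\<delta> \<beta> - \<delta> \<gamma>) * ((b i * v $ i) * (c j * v $ j)))"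
      by (simp only: mult.assoc[of "\<delta> \<beta> - \<delta> \<gamma>"] sum_distrib_left)
    show ?thesis
      unfolding 1 2 sum_subtractf[symmetric] q_def
      by (intro sum.cong refl) (simp add: algebra_simps)
  qed
  have "(\<Sum>i<n + 1. \<Sum>j<n + 1. q i j * (v $ i * v $ j)) = 0"
  proof (rule proj_closure_quadratic[OF P])
    fix x assume "x \<in> S"
    then show "(\<Sum>i<n + 1. \<Sum>j<n + 1. q i j * (affine_embed n x $ i * affine_embed n x $ j)) = 0"
      unfolding q using zc_affine_embed[OF _ R] by (simp add: affine_embed_def)
  qed
  then show ?thesis
    by (simp only: q right_minus_eq)
qed

text \<open>For equal values of \<open>\<delta>\<close> the quadric degenerates to
  \<open>(zc \<gamma> v - zc \<beta> v) * v $ n = 0\<close> and says nothing at infinity; the linear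
  relation on the curve survives there.\<close>

lemma closure_linear:
  assumes P: "P \<in> proj_closure n S" "v \<in> P" and R: "\<beta> \<in> R" "\<gamma> \<in> R" "\<delta> \<beta> = \<delta> \<gamma>"
  shows "zc \<gamma> v = zc \<beta> v"
proof -
  obtain b where b: "\<And>v. zc \<beta> v = (\<Sum>i<n + 1. b i * v $ i)"
    by (rule zc_linear_form[of \<beta>]) blast
  obtain c where c: "\<And>v. zc \<gamma> v = (\<Sum>i<n + 1. c i * v $ i)"
    by (rule zc_linear_form[of \<gamma>]) blast
  have q: "(\<Sum>i<n + 1. (c i - b i) * v $ i) = zc \<gamma> v - zc \<beta> v" for v
    unfolding b c by (simp add: left_diff_distrib sum_subtractf)
  have "(\<Sum>i<n + 1. (c i - b i) * v $ i) = 0"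
  proof (rule proj_closure_linear[OF P])
    fix x assume "x \<in> S"
    then show "(\<Sum>i<n + 1. (c i - b i) * affine_embed n x $ i) = 0"
      unfolding q using zc_affine_embed[OF _ R(1,2)] R(3) by simp
  qed
  then show ?thesis
    by (simp only: q right_minus_eq)
qed

lemma proj_closure_carrier:
  assumes "P \<in> proj_closure n S" "v \<in> P"
  shows "v \<in> carrier_vec (n + 1)" "v \<noteq> 0\<^sub>v (n + 1)" "P = proj_point v"
proof -
  obtain u where u: "P = proj_point u" "u \<in> carrier_vec (n + 1)" "u \<noteq> 0\<^sub>v (n + 1)"
    using assms(1) by (auto simp: proj_closure_def proj_space_def)
  then obtain c where c: "v = c \<cdot>\<^sub>v u" "c \<noteq> 0"
    using assms(2) by (auto simp: proj_point_def)
  show "v \<in> carrier_vec (n + 1)" using u c by simp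
  show "P = proj_point v" using u c by (simp add: proj_point_smult)
  show "v \<noteq> 0\<^sub>v (n + 1)"
  proof
    assume "v = 0\<^sub>v (n + 1)"
    moreover have "u = inverse c \<cdot>\<^sub>v v"
      using c by (simp add: smult_smult_assoc)
    ultimately have "u = 0\<^sub>v (n + 1)"
      by (auto intro!: eq_vecI)
    with u show False by blast
  qed
qed

section \<open>The points at infinity\<close>

text \<open>Scaling the point with parameter \<open>s\<close> by the product \<open>W\<close> of all
  \<open>s + \<delta> \<gamma>\<close> gives a polynomial path. At
  \<open>s = - \<delta> \<beta>\<close> the last coordinate and all normalised coordinates except
  the one at \<beta> vanish; that one survives because the other factors are nonzero by
  injectivity.\<close>

lemma pole_in_closure:
  assumes inj: "inj_on \<delta> R" and "\<beta> \<in> R"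
  shows "proj_point (pt 0 (\<lambda>\<gamma>. if \<gamma> = \<beta> then 1 else 0)) \<in> proj_closure n S"
proof -
  define W where "W = (\<Prod>\<gamma>\<in>R. [:\<delta> \<gamma>, 1:])"
  define Z where "Z \<gamma> = (\<Prod>\<epsilon>\<in>R - {\<gamma>}. [:\<delta> \<epsilon>, 1:])" for \<gamma>
  define Y where "Y i = (if i < n then \<Sum>\<gamma>\<in>R. smult (lagrange \<gamma> i) (smult (A \<gamma>) W + smult (B \<gamma>) (Z \<gamma>)) else W)" for i
  have V: "vec (n + 1) (\<lambda>i. poly (Y i) s) = pt (poly W s) (\<lambda>\<gamma>. poly (Z \<gamma>) s)" for s
    by (rule eq_vecI) (auto simp: Y_def pt_def poly_sum)
  have W: "poly W s = (s + \<delta> \<gamma>) * poly (Z \<gamma>) s" if "\<gamma> \<in> R" for s \<gamma>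
    using that finite_R unfolding W_def Z_def by (subst prod.remove[of R \<gamma>]) (auto simp: algebra_simps)
  have Z: "poly (Z \<gamma>) (- \<delta> \<beta>) = 0 \<longleftrightarrow> \<gamma> \<noteq> \<beta>" if "\<gamma> \<in> R" for \<gamma>
    using that \<open>\<beta> \<in> R\<close> finite_R inj by (auto simp: Z_def poly_prod inj_on_def)
  define c where "c = poly (Z \<beta>) (- \<delta> \<beta>)"
  have c: "c \<noteq> 0" using Z[OF \<open>\<beta> \<in> R\<close>] by (simp add: c_def)
  obtain E where E: "finite E" "\<And>s. s \<notin> E \<Longrightarrow> \<exists>x\<in>S. \<forall>\<gamma>\<in>R. s + \<delta> \<gamma> \<noteq> 0 \<and>
      (\<Sum>i<n. x $ i * \<gamma> ^ i) = A \<gamma> + B \<gamma> / (s + \<delta> \<gamma>)"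
    using S_points by blast
  have "proj_point (vec (n + 1) (\<lambda>i. poly (Y i) (- \<delta> \<beta>))) \<in> proj_closure n S"
  proof (rule proj_closure_path[OF E(1)])
    fix s assume "s \<notin> E"
    then obtain x where x: "x \<in> S" "\<And>\<gamma>. \<gamma> \<in> R \<Longrightarrow> s + \<delta> \<gamma> \<noteq> 0"
      "\<And>\<gamma>. \<gamma> \<in> R \<Longrightarrow> (\<Sum>i<n. x $ i * \<gamma> ^ i) = A \<gamma> + B \<gamma> / (s + \<delta> \<gamma>)"
      using E(2) by blast
    let ?v = "affine_embed n x"
    have "?v = pt 1 (\<lambda>\<gamma>. zc \<gamma> ?v)"
      using pt_zc[of ?v] by (simp add: affine_embed_def)
    also have "\<dots> = pt 1 (\<lambda>\<gamma>. 1 / (s + \<delta> \<gamma>))"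
      using x B by (intro pt_cong) (simp add: zc_def y_affine_embed, simp add: affine_embed_def)
    finally have "poly W s \<cdot>\<^sub>v ?v = pt (poly W s) (\<lambda>\<gamma>. poly (Z \<gamma>) s)"
      using x(2) W by (simp add: pt_smult) (rule pt_cong, simp)
    then show "\<exists>x\<in>S. \<exists>c. vec (n + 1) (\<lambda>i. poly (Y i) s) = c \<cdot>\<^sub>v affine_embed n x"
      using x(1) V by metis
  next
    show "vec (n + 1) (\<lambda>i. poly (Y i) (- \<delta> \<beta>)) \<noteq> 0\<^sub>v (n + 1)"
      unfolding V pt_eq_0_iff using c \<open>\<beta> \<in> R\<close> by (auto simp: c_def)
  qed
  also have "vec (n + 1) (\<lambda>i. poly (Y i) (- \<delta> \<beta>)) = c \<cdot>\<^sub>v pt 0 (\<lambda>\<gamma>. if \<gamma> = \<beta> then 1 else 0)"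
    unfolding V pt_smult using W[OF \<open>\<beta> \<in> R\<close>, of "- \<delta> \<beta>"] Z
    by simp (rule pt_cong, auto simp: c_def)
  finally show ?thesis
    using c by (simp add: proj_point_smult)
qed

lemma pt_pole:
  assumes "\<beta> \<in> R"
  shows "pt 0 (\<lambda>\<gamma>. if \<gamma> = \<beta> then 1 else 0) = (B \<beta> / poly (cofactor R \<beta>) \<beta>) \<cdot>\<^sub>v
    vec (n + 1) (\<lambda>i. if i < n then poly.coeff (cofactor R \<beta>) i else 0)"
proof (rule eq_vecI)
  fix i assume "i < dim_vec ((B \<beta> / poly (cofactor R \<beta>) \<beta>) \<cdot>\<^sub>v
    vec (n + 1) (\<lambda>i. if i < n then poly.coeff (cofactor R \<beta>) i else 0))"
  moreover have "(\<Sum>\<gamma>\<in>R. lagrange \<gamma> i * (B \<gamma> * (if \<gamma> = \<beta> then 1 else 0))) =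
      (\<Sum>\<gamma>\<in>R. if \<gamma> = \<beta> then lagrange \<gamma> i * B \<gamma> else 0)"
    by (intro sum.cong) auto
  ultimately show "pt 0 (\<lambda>\<gamma>. if \<gamma> = \<beta> then 1 else 0) $ i = ((B \<beta> / poly (cofactor R \<beta>) \<beta>) \<cdot>\<^sub>v
    vec (n + 1) (\<lambda>i. if i < n then poly.coeff (cofactor R \<beta>) i else 0)) $ i"
    using assms finite_R by (auto simp: pt_def lagrange_def)
qed (simp add: pt_def)

lemma points_at_infinity_eq:
  assumes inj: "inj_on \<delta> R"
  shows "points_at_infinity n (zariski_closure n S) =
    (\<lambda>\<beta>. proj_point (vec (n + 1) (\<lambda>i. if i < n then poly.coeff (cofactor R \<beta>) i else 0))) ` R"
proof -
  let ?pole = "\<lambda>\<beta>. pt 0 (\<lambda>\<gamma>. if \<gamma> = \<beta> then 1 else 0)"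
  have "points_at_infinity n (zariski_closure n S) = (\<lambda>\<beta>. proj_point (?pole \<beta>)) ` R"
  proof (intro equalityI subsetI)
    fix P assume "P \<in> points_at_infinity n (zariski_closure n S)"
    then have P: "P \<in> proj_closure n S" "\<And>v. v \<in> P \<Longrightarrow> v $ n = 0"
      by (auto simp: points_at_infinity_def proj_closure_zariski_closure[OF S])
    then obtain v where v: "v \<in> P"
      using proj_point_self by (fastforce simp: proj_closure_def proj_space_def)
    note v' = proj_closure_carrier[OF P(1) v]
    have pt_v: "v = pt 0 (\<lambda>\<beta>. zc \<beta> v)"
      using pt_zc[OF v'(1)] P(2)[OF v] by simp
    then obtain \<beta> where \<beta>: "\<beta> \<in> R" "zc \<beta> v \<noteq> 0"
      using v'(2) pt_eq_0_iff[of 0 "\<lambda>\<beta>. zc \<beta> v"] by auto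
    \<comment> \<open>With \<open>v $ n = 0\<close> the quadric leaves a vanishing product, in which
      injectivity of \<open>\<delta>\<close> and the choice of \<beta> exclude the other
      factors.\<close>
    have "zc \<gamma> v = 0" if "\<gamma> \<in> R" "\<gamma> \<noteq> \<beta>" for \<gamma>
      using closure_quadric[OF P(1) v \<beta>(1) that(1)] P(2)[OF v] \<beta> that inj
      by (auto simp: inj_on_def)
    then have "v = zc \<beta> v \<cdot>\<^sub>v ?pole \<beta>"
      by (subst pt_v) (auto simp: pt_smult intro: pt_cong)
    then have "P = proj_point (?pole \<beta>)"
      using v'(3) \<beta>(2) by (metis proj_point_smult)
    then show "P \<in> (\<lambda>\<beta>. proj_point (?pole \<beta>)) ` R"
      using \<beta>(1) by blast
  next
    fix P assume "P \<in> (\<lambda>\<beta>. proj_point (?pole \<beta>)) ` R"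
    then obtain \<beta> where "\<beta> \<in> R" "P = proj_point (?pole \<beta>)" by blast
    then show "P \<in> points_at_infinity n (zariski_closure n S)"
      using pole_in_closure[OF inj]
      by (auto simp: points_at_infinity_def proj_closure_zariski_closure[OF S] proj_point_def pt_smult)
  qed
  also have "\<dots> = (\<lambda>\<beta>. proj_point (vec (n + 1) (\<lambda>i. if i < n then poly.coeff (cofactor R \<beta>) i else 0))) ` R"
    using B cofactor_root by (intro image_cong) (auto simp: pt_pole proj_point_smult)
  finally show ?thesis .
qed

section \<open>Hyperplane sections\<close>

text \<open>A hyperplane is linear in \<open>w\<close> and \<open>Z\<close>: the coefficient of
  \<open>w\<close> is its value at the point with parameter infinity, where all
  \<open>Z \<beta>\<close> are 0.\<close>

lemma scalar_prod_pt:
  assumes "a \<in> carrier_vec (n + 1)"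
  shows "a \<bullet> pt w Z = w * (a \<bullet> pt 1 (\<lambda>_. 0)) + (\<Sum>\<beta>\<in>R. Z \<beta> * (\<Sum>i<n. a $ i * lagrange \<beta> i * B \<beta>))"
proof -
  have "a \<bullet> pt w Z = (\<Sum>i<n. a $ i * (\<Sum>\<beta>\<in>R. lagrange \<beta> i * (A \<beta> * w + B \<beta> * Z \<beta>))) + a $ n * w" for w Z
    by (simp add: scalar_prod_def pt_def atLeast0LessThan)
  note * = this
  have "(\<Sum>i<n. a $ i * (\<Sum>\<beta>\<in>R. lagrange \<beta> i * (A \<beta> * w + B \<beta> * Z \<beta>))) =
      w * (\<Sum>i<n. a $ i * (\<Sum>\<beta>\<in>R. lagrange \<beta> i * A \<beta>)) +
      (\<Sum>i<n. \<Sum>\<beta>\<in>R. Z \<beta> * (a $ i * lagrange \<beta> i * B \<beta>))"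
    by (simp add: sum_distrib_left sum.distrib[symmetric] algebra_simps)
  also have "(\<Sum>i<n. \<Sum>\<beta>\<in>R. Z \<beta> * (a $ i * lagrange \<beta> i * B \<beta>)) =
      (\<Sum>\<beta>\<in>R. Z \<beta> * (\<Sum>i<n. a $ i * lagrange \<beta> i * B \<beta>))"
    by (subst sum.swap) (simp add: sum_distrib_left)
  finally show ?thesis
    by (simp add: * algebra_simps)
qed

text \<open>
  A generic hyperplane avoids the poles and the point with parameter infinity; its remaining
  intersections with the curve correspond to the roots of a polynomial whose degree is the
  number of distinct values of \<open>\<delta>\<close>.
\<close>

lemma inj_on_of_degree:
  assumes "curve_has_degree n (zariski_closure n S) n"
  shows "inj_on \<delta> R"
proof -
  define \<Delta> where "\<Delta> = \<delta> ` R"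
  have "finite \<Delta>" using finite_R by (simp add: \<Delta>_def)
  obtain G where G: "G \<in> multipolys (n + 1)" "G \<noteq> 0"
    "\<And>a. a \<in> carrier_vec (n + 1) \<Longrightarrow> a \<noteq> 0\<^sub>v (n + 1) \<Longrightarrow> eval_mp G a \<noteq> 0 \<Longrightarrow>
       card (proj_closure n S \<inter> hyperplane n a) = n"
    using assms unfolding curve_has_degree_def proj_closure_zariski_closure[OF S] by blast
  \<comment> \<open>If several elements of \<open>R\<close> share the value \<open>d\<close>, the
    linear relations force their coordinates to agree, so up to a scalar this is the only candidate
    at infinity for \<open>d\<close>.\<close>
  define e where "e d = pt 0 (\<lambda>\<beta>. if \<delta> \<beta> = d then 1 else 0)" for d
  define T where "T = insert (pt 1 (\<lambda>_. 0)) (e ` \<Delta>)"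
  have "finite T" "T \<subseteq> carrier_vec (n + 1)"
    using \<open>finite \<Delta>\<close> by (auto simp: T_def e_def)
  moreover have "0\<^sub>v (n + 1) \<notin> T"
  proof
    assume "0\<^sub>v (n + 1) \<in> T"
    then consider "pt 1 (\<lambda>_. 0) = 0\<^sub>v (n + 1)" | \<beta> where "\<beta> \<in> R" "e (\<delta> \<beta>) = 0\<^sub>v (n + 1)"
      by (auto simp: T_def \<Delta>_def)
    then show False
      by cases (auto simp: e_def pt_eq_0_iff[simplified])
  qed
  ultimately obtain a where a: "a \<in> carrier_vec (n + 1)" "eval_mp G a \<noteq> 0"
    "\<And>v. v \<in> T \<Longrightarrow> a \<bullet> v \<noteq> 0"
    using generic_point_exists[OF G(1,2)] by blast
  define a0 where "a0 = a \<bullet> pt 1 (\<lambda>_. 0)"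
  have "a0 \<noteq> 0" using a(3) by (simp add: a0_def T_def)
  then have "a \<noteq> 0\<^sub>v (n + 1)" by (auto simp: a0_def)
  then have card: "card (proj_closure n S \<inter> hyperplane n a) = n"
    using G(3) a by blast
  define b where "b \<beta> = (\<Sum>i<n. a $ i * lagrange \<beta> i * B \<beta>)" for \<beta>
  \<comment> \<open>The hyperplane equation at parameter \<open>t\<close>, multiplied by
    \<open>t + d\<close> once for each distinct value \<open>d\<close>. Its leading coefficient is
    \<open>a0\<close>, so the degree is exactly \<open>card \<Delta>\<close>.\<close>
  define H where "H = smult a0 (\<Prod>d\<in>\<Delta>. [:d, 1:]) +
    (\<Sum>\<beta>\<in>R. smult (b \<beta>) (\<Prod>d\<in>\<Delta> - {\<delta> \<beta>}. [:d, 1:]))"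
  have "degree (smult (b \<beta>) (\<Prod>d\<in>\<Delta> - {\<delta> \<beta>}. [:d, 1:])) < card \<Delta>" if "\<beta> \<in> R" for \<beta>
  proof -
    have "\<delta> \<beta> \<in> \<Delta>" using that by (simp add: \<Delta>_def)
    then have "card (\<Delta> - {\<delta> \<beta>}) < card \<Delta>"
      using \<open>finite \<Delta>\<close> by (rule card_Diff1_less[rotated])
    moreover have "degree (\<Prod>d\<in>\<Delta> - {\<delta> \<beta>}. [:d, 1:]) = card (\<Delta> - {\<delta> \<beta>})"
      by (subst degree_prod_eq_sum_degree) auto
    ultimately show ?thesis
      using degree_smult_le[of "b \<beta>"] by (metis le_less_trans)
  qed
  moreover have "R \<noteq> {}" using card_R n_pos by auto
  then have "card \<Delta> > 0" using \<open>finite \<Delta>\<close> by (auto simp: \<Delta>_def card_gt_0_iff)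
  ultimately have small: "degree (\<Sum>\<beta>\<in>R. smult (b \<beta>) (\<Prod>d\<in>\<Delta> - {\<delta> \<beta>}. [:d, 1:])) < card \<Delta>"
    by (intro degree_sum_less)
  have "degree (smult a0 (\<Prod>d\<in>\<Delta>. [:d, 1:])) = card \<Delta>"
    using \<open>a0 \<noteq> 0\<close> by (simp, subst degree_prod_eq_sum_degree) auto
  then have degH: "degree H = card \<Delta>"
    using small by (simp add: H_def degree_add_eq_left)
  with \<open>card \<Delta> > 0\<close> have "H \<noteq> 0" by auto
  define f where "f t = proj_point (pt 1 (\<lambda>\<beta>. 1 / (t + \<delta> \<beta>)))" for t
  have "proj_closure n S \<inter> hyperplane n a \<subseteq> f ` {t. poly H t = 0}"
  proof
    fix P assume P: "P \<in> proj_closure n S \<inter> hyperplane n a"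
    then have PS: "P \<in> proj_closure n S" by blast
    then obtain v where v: "v \<in> P"
      using proj_point_self by (fastforce simp: proj_closure_def proj_space_def)
    note v' = proj_closure_carrier[OF PS v]
    note quadric = closure_quadric[OF PS v] and linear = closure_linear[OF PS v]
    have av: "a \<bullet> v = 0" using P v by (auto simp: hyperplane_def)
    have pt_v: "v = pt (v $ n) (\<lambda>\<beta>. zc \<beta> v)"
      using pt_zc[OF v'(1)] by simp
    \<comment> \<open>Otherwise \<open>v\<close> would be a multiple of some \<open>e d\<close>,
      which the hyperplane avoids.\<close>
    have w: "v $ n \<noteq> 0"
    proof
      assume w0: "v $ n = 0"
      then obtain \<beta> where \<beta>: "\<beta> \<in> R" "zc \<beta> v \<noteq> 0"
        using v'(2) pt_v pt_eq_0_iff[of 0 "\<lambda>\<beta>. zc \<beta> v"] by auto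
      have "zc \<gamma> v = (if \<delta> \<gamma> = \<delta> \<beta> then zc \<beta> v else 0)" if "\<gamma> \<in> R" for \<gamma>
        using quadric[OF \<beta>(1) that] linear[OF \<beta>(1) that] w0 \<beta>(2) by auto
      then have "v = zc \<beta> v \<cdot>\<^sub>v e (\<delta> \<beta>)"
        using w0 by (subst pt_v) (auto simp: pt_smult e_def intro: pt_cong)
      moreover have "e (\<delta> \<beta>) \<in> T" "e (\<delta> \<beta>) \<in> carrier_vec (n + 1)"
        using \<beta>(1) by (auto simp: T_def \<Delta>_def e_def)
      ultimately show False
        using a(1,3) av \<beta>(2) by (metis mult_eq_0_iff scalar_prod_smult_right carrier_vecD)
    qed
    define Z where "Z \<beta> = zc \<beta> v / v $ n" for \<beta>
    have v_eq: "v = v $ n \<cdot>\<^sub>v pt 1 Z"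
      using w by (subst pt_v) (simp add: pt_smult Z_def)
    have quadZ: "Z \<gamma> - Z \<beta> = (\<delta> \<beta> - \<delta> \<gamma>) * Z \<beta> * Z \<gamma>" if "\<beta> \<in> R" "\<gamma> \<in> R" for \<beta> \<gamma>
    proof -
      have "Z \<gamma> - Z \<beta> = ((zc \<gamma> v - zc \<beta> v) * v $ n) / (v $ n * v $ n)"
        using w by (simp add: Z_def diff_divide_distrib)
      then show ?thesis
        by (simp add: quadric[OF that] Z_def)
    qed
    have aZ: "a \<bullet> pt 1 Z = 0"
      using av w a(1) v_eq by (metis mult_eq_0_iff scalar_prod_smult_right carrier_vecD pt_carrier)
    \<comment> \<open>By the quadrics one vanishing coordinate makes all vanish, which is the
      avoided point with parameter infinity.\<close>
    have Z0: "Z \<beta> \<noteq> 0" if "\<beta> \<in> R" for \<beta>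
    proof
      assume "Z \<beta> = 0"
      then have "pt 1 Z = pt 1 (\<lambda>_. 0)"
        using quadZ[OF that] by (intro pt_cong) simp
      then show False using aZ \<open>a0 \<noteq> 0\<close> by (simp add: a0_def)
    qed
    obtain \<beta>0 where \<beta>0: "\<beta>0 \<in> R" using \<open>R \<noteq> {}\<close> by blast
    \<comment> \<open>Inverts \<open>Z = 1 / (t + \<delta>)\<close> in one coordinate; the quadrics
      give the same parameter in every other coordinate.\<close>
    define t where "t = 1 / Z \<beta>0 - \<delta> \<beta>0"
    have Zt: "(t + \<delta> \<beta>) * Z \<beta> = 1" if "\<beta> \<in> R" for \<beta>
      using quadZ[OF \<beta>0 that] Z0[OF \<beta>0] Z0[OF that] by (simp add: t_def field_simps)
    then have Zt': "t + \<delta> \<beta> \<noteq> 0" "Z \<beta> = 1 / (t + \<delta> \<beta>)" if "\<beta> \<in> R" for \<beta>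
      using that by (force, metis mult_zero_left nonzero_eq_divide_eq mult.commute zero_neq_one)
    have "P = f t"
    proof -
      have "P = proj_point (pt 1 Z)"
        using v'(3) v_eq w by (metis proj_point_smult)
      also have "pt 1 Z = pt 1 (\<lambda>\<beta>. 1 / (t + \<delta> \<beta>))"
        using Zt' by (intro pt_cong)
      finally show ?thesis by (simp add: f_def)
    qed
    moreover have "poly H t = 0"
    proof -
      define W where "W = (\<Prod>d\<in>\<Delta>. d + t)"
      have quot: "(\<Prod>d\<in>\<Delta> - {\<delta> \<beta>}. d + t) = W * Z \<beta>" if "\<beta> \<in> R" for \<beta>
      proof -
        have "W = (\<delta> \<beta> + t) * (\<Prod>d\<in>\<Delta> - {\<delta> \<beta>}. d + t)"
          unfolding W_def using that \<open>finite \<Delta>\<close> by (intro prod.remove) (auto simp: \<Delta>_def)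
        then show ?thesis
          using Zt'[OF that] by (simp add: add.commute)
      qed
      have "poly H t = a0 * W + (\<Sum>\<beta>\<in>R. b \<beta> * (\<Prod>d\<in>\<Delta> - {\<delta> \<beta>}. d + t))"
        by (simp add: H_def poly_sum poly_prod W_def)
      also have "\<dots> = a0 * W + (\<Sum>\<beta>\<in>R. b \<beta> * (W * Z \<beta>))"
        using quot by simp
      also have "\<dots> = W * (a0 + (\<Sum>\<beta>\<in>R. Z \<beta> * b \<beta>))"
        by (simp add: distrib_left sum_distrib_left mult_ac)
      also have "a0 + (\<Sum>\<beta>\<in>R. Z \<beta> * b \<beta>) = 0"
        using aZ scalar_prod_pt[OF a(1), of 1 Z] by (simp add: a0_def b_def)
      finally show ?thesis by simp
    qed
    ultimately show "P \<in> f ` {t. poly H t = 0}" by blast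
  qed
  moreover have "finite {t. poly H t = 0}" "card {t. poly H t = 0} \<le> card \<Delta>"
    using poly_roots_finite[OF \<open>H \<noteq> 0\<close>] card_poly_roots_bound[OF \<open>H \<noteq> 0\<close>] degH by auto
  ultimately have "n \<le> card \<Delta>"
    using card by (metis (no_types, lifting) card_image_le card_mono finite_imageI le_trans)
  then show ?thesis
    using card_R finite_R unfolding \<Delta>_def by (intro eq_card_imp_inj_on) (auto simp: card_image_le le_antisym)
qed

end

section \<open>Values of rational functions\<close>

lemma rat_fun_value_unique: "rat_fun_value f t y \<Longrightarrow> rat_fun_value f t z \<Longrightarrow> y = z"
  unfolding rat_fun_value_def
proof safe
  fix p q p' q' :: "'a poly"
  assume *: "Fract p q = Fract p' q'" "poly q t \<noteq> 0" "poly q' t \<noteq> 0"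
  then have "p * q' = p' * q"
    by (subst (asm) eq_fract) auto
  then have "poly p t * poly q' t = poly p' t * poly q t"
    by (metis poly_mult)
  then show "poly p t / poly q t = poly p' t / poly q' t"
    using * by (simp add: field_simps)
qed

lemma rat_fun_value_Fract: "poly q t \<noteq> 0 \<Longrightarrow> rat_fun_value (Fract p q) t (poly p t / poly q t)"
  unfolding rat_fun_value_def by blast

lemma rat_fun_value_poly: "rat_fun_value (Fract p 1) t (poly p t)"
  using rat_fun_value_Fract[of 1 t p] by simp

lemma rat_fun_value_add:
  "rat_fun_value f t y \<Longrightarrow> rat_fun_value g t z \<Longrightarrow> rat_fun_value (f + g) t (y + z)"
  unfolding rat_fun_value_def
proof safe
  fix p q p' q' :: "'a poly"
  assume "poly q t \<noteq> 0" "poly q' t \<noteq> 0"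
  moreover from this have "q \<noteq> 0" "q' \<noteq> 0" by auto
  ultimately show "\<exists>p'' q''. Fract p q + Fract p' q' = Fract p'' q'' \<and> poly q'' t \<noteq> 0 \<and>
      poly p t / poly q t + poly p' t / poly q' t = poly p'' t / poly q'' t"
    by (rule_tac x = "p * q' + p' * q" in exI, rule_tac x = "q * q'" in exI) (simp add: add_frac_eq)
qed

lemma rat_fun_value_mult:
  "rat_fun_value f t y \<Longrightarrow> rat_fun_value g t z \<Longrightarrow> rat_fun_value (f * g) t (y * z)"
  unfolding rat_fun_value_def
proof safe
  fix p q p' q' :: "'a poly"
  assume "poly q t \<noteq> 0" "poly q' t \<noteq> 0"
  then show "\<exists>p'' q''. Fract p q * Fract p' q' = Fract p'' q'' \<and> poly q'' t \<noteq> 0 \<and>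
      poly p t / poly q t * (poly p' t / poly q' t) = poly p'' t / poly q'' t"
    by (rule_tac x = "p * p'" in exI, rule_tac x = "q * q'" in exI) simp
qed

lemma rat_fun_value_sum:
  assumes "\<And>i. i \<in> I \<Longrightarrow> rat_fun_value (f i) t (y i)"
  shows "rat_fun_value (sum f I) t (sum y I)"
proof -
  have "rat_fun_value 0 t 0"
    using rat_fun_value_poly[of 0 t] by (simp add: Zero_fract_def)
  then show ?thesis
    using assms by (induction I rule: infinite_finite_induct) (auto intro: rat_fun_value_add)
qed

lemma rat_fun_eqI:
  fixes f g :: "'a::field poly fract"
  assumes T: "infinite T" and eq: "\<And>t. t \<in> T \<Longrightarrow> \<exists>y. rat_fun_value f t y \<and> rat_fun_value g t y"
  shows "f = g"
proof -
  obtain p q where f: "f = Fract p q" "q \<noteq> 0" by (cases f)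
  obtain p' q' where g: "g = Fract p' q'" "q' \<noteq> 0" by (cases g)
  let ?E = "{t. poly (q * q') t = 0}"
  have "finite ?E" using f g by (intro poly_roots_finite) simp
  then have "infinite (T - ?E)" using T by (rule Diff_infinite_finite)
  moreover have "T - ?E \<subseteq> {t. poly (p * q' - p' * q) t = 0}"
  proof
    fix t assume t: "t \<in> T - ?E"
    then obtain y where "rat_fun_value f t y" "rat_fun_value g t y" using eq by blast
    moreover have "rat_fun_value f t (poly p t / poly q t)" "rat_fun_value g t (poly p' t / poly q' t)"
      using t by (auto simp: f g intro!: rat_fun_value_Fract)
    ultimately have "poly p t / poly q t = poly p' t / poly q' t"
      by (metis rat_fun_value_unique)
    then show "t \<in> {t. poly (p * q' - p' * q) t = 0}"
      using t by (simp add: field_simps)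
  qed
  ultimately have "p * q' - p' * q = 0"
    using poly_roots_finite finite_subset by blast
  then show ?thesis
    using f g by (simp add: eq_fract)
qed

section \<open>Hypercircles in conjugate coordinates\<close>

lemma rat_funs_base_field:
  assumes "f \<in> rat_funs base_field"
  obtains p q where "f = Fract (map_poly to_ac p) (map_poly to_ac q)" "q \<noteq> 0"
proof -
  obtain p q where pq: "f = Fract p q" "q \<noteq> 0"
    "\<And>i. poly.coeff p i \<in> base_field" "\<And>i. poly.coeff q i \<in> base_field"
    using assms by (auto simp: rat_funs_def)
  have lift: "map_poly to_ac (map_poly of_ac r) = r" if "\<And>i. poly.coeff r i \<in> base_field" for r :: "'a alg_closure poly"
    by (rule poly_eqI) (simp add: coeff_map_poly to_ac_of_ac[OF that])
  show ?thesis
    using that[of "map_poly of_ac p" "map_poly of_ac q"] pq lift[of p] lift[of q]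
    by (metis map_poly_0)
qed

text \<open>
  Comparing values at the infinitely many points of the base field transfers the defining
  identity of the components from \<open>\<alpha>\<close> to its conjugates.
\<close>

lemma components_conjugate:
  fixes \<alpha> :: "'k::field_char_0 alg_closure"
  assumes \<phi>: "\<And>i. i < n \<Longrightarrow> \<phi> i = Fract (map_poly to_ac (p i)) (map_poly to_ac (q i))"
      "\<And>i. i < n \<Longrightarrow> q i \<noteq> 0"
    and eq: "Fract [:ev pd \<alpha>, ev pc \<alpha>:] 1 * (\<Sum>i<n. \<phi> i * Fract [:\<alpha> ^ i:] 1) = Fract [:ev pb \<alpha>, ev pa \<alpha>:] 1"
    and \<beta>: "ev (min_poly \<alpha>) \<beta> = 0"
  shows "Fract [:ev pd \<beta>, ev pc \<beta>:] 1 * (\<Sum>i<n. \<phi> i * Fract [:\<beta> ^ i:] 1) = Fract [:ev pb \<beta>, ev pa \<beta>:] 1"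
proof (rule rat_fun_eqI)
  define K where "K = {k. poly (\<Prod>i<n. q i) k \<noteq> 0}"
  have "finite (- K)"
    unfolding K_def Compl_eq using \<phi>(2) by (simp only: mem_Collect_eq not_not) (rule poly_roots_finite, simp)
  then have "infinite K"
    using infinite_UNIV_char_0 finite_compl by metis
  then show "infinite (to_ac ` K)"
    using inj_to_ac finite_imageD inj_on_subset by blast
  fix t assume "t \<in> to_ac ` K"
  then obtain k where k: "t = to_ac k" "\<And>i. i < n \<Longrightarrow> poly (q i) k \<noteq> 0"
    by (auto simp: K_def poly_prod)
  define x where "x i = poly (p i) k / poly (q i) k" for i
  have x: "rat_fun_value (\<phi> i) t (to_ac (x i))" if "i < n" for i
    using rat_fun_value_Fract[of "map_poly to_ac (q i)" t "map_poly to_ac (p i)"] k that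
    by (simp add: \<phi>(1) x_def ev_to_ac flip: ev_def)
  \<comment> \<open>At the base field point \<open>k\<close> the left side is the value of a single
    polynomial \<open>F\<close> over the base field, the same for all conjugates, so equality at
    \<alpha> transfers to \<beta>.\<close>
  define F where "F = (pd + smult k pc) * (\<Sum>i<n. Polynomial.monom (x i) i)"
  have lhs: "rat_fun_value (Fract [:ev pd \<gamma>, ev pc \<gamma>:] 1 * (\<Sum>i<n. \<phi> i * Fract [:\<gamma> ^ i:] 1)) t (ev F \<gamma>)" for \<gamma>
  proof -
    have "rat_fun_value (Fract [:ev pd \<gamma>, ev pc \<gamma>:] 1 * (\<Sum>i<n. \<phi> i * Fract [:\<gamma> ^ i:] 1)) t
        (poly [:ev pd \<gamma>, ev pc \<gamma>:] t * (\<Sum>i<n. to_ac (x i) * poly [:\<gamma> ^ i:] t))"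
      by (intro rat_fun_value_mult rat_fun_value_sum rat_fun_value_poly x) simp
    then show ?thesis
      by (simp add: F_def ev_sum k)
  qed
  have rhs: "rat_fun_value (Fract [:ev pb \<gamma>, ev pa \<gamma>:] 1) t (ev (pb + smult k pa) \<gamma>)" for \<gamma>
    using rat_fun_value_poly[of "[:ev pb \<gamma>, ev pa \<gamma>:]" t] by (simp add: k)
  have "ev F \<alpha> = ev (pb + smult k pa) \<alpha>"
    using lhs[of \<alpha>] rhs[of \<alpha>] unfolding eq by (rule rat_fun_value_unique)
  then have "ev F \<beta> = ev (pb + smult k pa) \<beta>"
    by (rule ev_conjugate_cong[OF \<beta>])
  then show "\<exists>y. rat_fun_value (Fract [:ev pd \<beta>, ev pc \<beta>:] 1 * (\<Sum>i<n. \<phi> i * Fract [:\<beta> ^ i:] 1)) t y \<and>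
      rat_fun_value (Fract [:ev pb \<beta>, ev pa \<beta>:] 1) t y"
    by (intro exI conjI) (rule lhs, simp only: rhs)
qed

section \<open>Reduction of hypercircles to partial fractions\<close>

text \<open>The hypothesis on \<open>y\<close> is free of denominators, so it is available before
  \<open>c * t + d \<noteq> 0\<close> is known; a zero there would kill the numerator too and
  contradict the determinant.\<close>

lemma moebius_partial_fraction:
  fixes a b c d t y :: "'a::field"
  assumes "a * d - b * c \<noteq> 0" "(c * t + d) * y = a * t + b"
  shows "c * t + d \<noteq> 0"
    and "c \<noteq> 0 \<Longrightarrow> y = a / c + ((b * c - a * d) / c ^ 2) / (t + d / c)"
    and "c \<noteq> 0 \<Longrightarrow> t + d / c \<noteq> 0"
    and "c \<noteq> 0 \<Longrightarrow> (y - a / c) / ((b * c - a * d) / c ^ 2) = 1 / (t + d / c)"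
    and "c = 0 \<Longrightarrow> y = b / d + a / d * t"
proof -
  show nz: "c * t + d \<noteq> 0"
  proof
    assume "c * t + d = 0"
    then have "d = - (c * t)" "b = - (a * t)"
      using assms(2) by (auto simp: eq_neg_iff_add_eq_0 add.commute)
    then show False using assms(1) by (simp add: algebra_simps)
  qed
  show c: "t + d / c \<noteq> 0" if "c \<noteq> 0"
    using nz that by (simp add: field_simps)
  have y: "y = (a * t + b) / (c * t + d)"
    using assms(2) nz by (simp add: field_simps)
  show *: "y = a / c + ((b * c - a * d) / c ^ 2) / (t + d / c)" if "c \<noteq> 0"
  proof -
    have "t + d / c = (c * t + d) / c" using that by (simp add: field_simps)
    then show ?thesis
      unfolding y using that nz by (simp add: divide_simps power2_eq_square) (simp add: algebra_simps)
  qed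
  show "(y - a / c) / ((b * c - a * d) / c ^ 2) = 1 / (t + d / c)" if "c \<noteq> 0"
    using *[OF that] that assms(1) by simp
  show "y = b / d + a / d * t" if "c = 0"
    unfolding y using that nz by (simp add: add_divide_distrib)
qed

lemma finite_conjugates: "finite {\<beta>. ev (min_poly \<alpha>) \<beta> = 0}"
  unfolding ev_def by (rule poly_roots_finite) (simp add: map_poly_eq_0_iff)

text \<open>Vanishing of \<open>c\<close> and nonvanishing of the determinant are relations over the
  base field, so they are common to all conjugates: the case split is uniform on \<open>R\<close>
  and every \<open>B \<beta>\<close> is nonzero.\<close>

lemma hypercircle_partial_fractions:
  fixes \<alpha> :: "'k::field_char_0 alg_closure"
  assumes "hypercircle \<alpha> C"
  obtains A B \<delta> S where
    "partial_fraction_curve (ext_degree \<alpha>) {\<beta>. ev (min_poly \<alpha>) \<beta> = 0} A B \<delta> S"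
    "C = zariski_closure (ext_degree \<alpha>) S"
proof -
  define n where "n = ext_degree \<alpha>"
  define R where "R = {\<beta>. ev (min_poly \<alpha>) \<beta> = 0}"
  obtain u \<phi> where u: "u \<in> unit_funs (simple_ext \<alpha>)" and comp: "components \<alpha> u \<phi>"
    and C: "C = zariski_closure n (rat_param_image n \<phi>)"
    using assms unfolding hypercircle_def n_def by blast
  obtain pa pb pc pd where u_eq: "u = Fract [:ev pb \<alpha>, ev pa \<alpha>:] [:ev pd \<alpha>, ev pc \<alpha>:]"
    and det: "ev pa \<alpha> * ev pd \<alpha> - ev pb \<alpha> * ev pc \<alpha> \<noteq> 0"
    using u by (auto simp: unit_funs_def simple_ext_eq)
  have "\<forall>i<n. \<exists>p q. \<phi> i = Fract (map_poly to_ac p) (map_poly to_ac q) \<and> q \<noteq> 0"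
    using comp rat_funs_base_field unfolding components_def n_def by metis
  then obtain p q where pq: "\<And>i. i < n \<Longrightarrow> \<phi> i = Fract (map_poly to_ac (p i)) (map_poly to_ac (q i))"
    "\<And>i. i < n \<Longrightarrow> q i \<noteq> 0"
    by metis
  have "[:ev pd \<alpha>, ev pc \<alpha>:] \<noteq> 0"
    using det by auto
  then have "Fract [:ev pd \<alpha>, ev pc \<alpha>:] 1 * u = Fract [:ev pb \<alpha>, ev pa \<alpha>:] 1"
    unfolding u_eq mult_fract by (subst eq_fract) auto
  then have eq: "Fract [:ev pd \<alpha>, ev pc \<alpha>:] 1 * (\<Sum>i<n. \<phi> i * Fract [:\<alpha> ^ i:] 1) = Fract [:ev pb \<alpha>, ev pa \<alpha>:] 1"
    using comp by (simp add: components_def n_def)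
  define a b c d where "a \<beta> = ev pa \<beta>" and "b \<beta> = ev pb \<beta>" and "c \<beta> = ev pc \<beta>" and "d \<beta> = ev pd \<beta>" for \<beta>
  have det: "a \<beta> * d \<beta> - b \<beta> * c \<beta> \<noteq> 0" if "\<beta> \<in> R" for \<beta>
    using ev_conjugate_iff[of \<alpha> \<beta> "pa * pd - pb * pc"] that det
    by (simp add: R_def a_def b_def c_def d_def)
  have c: "c \<beta> = 0 \<longleftrightarrow> c \<alpha> = 0" if "\<beta> \<in> R" for \<beta>
    using ev_conjugate_iff[of \<alpha> \<beta> pc] that by (simp add: R_def c_def)
  have moebius: "(c \<beta> * t + d \<beta>) * (\<Sum>i<n. x $ i * \<beta> ^ i) = a \<beta> * t + b \<beta>"
    if "\<beta> \<in> R" and x: "\<And>i. i < n \<Longrightarrow> rat_fun_value (\<phi> i) t (x $ i)" for \<beta> t x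
  proof -
    have "rat_fun_value (Fract [:d \<beta>, c \<beta>:] 1 * (\<Sum>i<n. \<phi> i * Fract [:\<beta> ^ i:] 1)) t
        (poly [:d \<beta>, c \<beta>:] t * (\<Sum>i<n. x $ i * poly [:\<beta> ^ i:] t))"
      by (intro rat_fun_value_mult rat_fun_value_sum rat_fun_value_poly x) simp
    moreover have "Fract [:d \<beta>, c \<beta>:] 1 * (\<Sum>i<n. \<phi> i * Fract [:\<beta> ^ i:] 1) = Fract [:b \<beta>, a \<beta>:] 1"
      unfolding a_def b_def c_def d_def
      by (rule components_conjugate[OF pq eq]) (use \<open>\<beta> \<in> R\<close> in \<open>auto simp: R_def\<close>)
    ultimately have "rat_fun_value (Fract [:b \<beta>, a \<beta>:] 1) t
        (poly [:d \<beta>, c \<beta>:] t * (\<Sum>i<n. x $ i * poly [:\<beta> ^ i:] t))"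
      by (simp only:)
    from rat_fun_value_unique[OF this rat_fun_value_poly]
    have "poly [:d \<beta>, c \<beta>:] t * (\<Sum>i<n. x $ i * poly [:\<beta> ^ i:] t) = poly [:b \<beta>, a \<beta>:] t" .
    then show ?thesis
      by (simp add: algebra_simps)
  qed
  note mf = moebius_partial_fraction[OF det moebius]
  define E where "E = (\<Union>i<n. {t. poly (map_poly to_ac (q i)) t = 0})"
  have "finite E"
    unfolding E_def using pq(2) by (auto intro!: poly_roots_finite simp: map_poly_eq_0_iff)
  have defined: "\<exists>x\<in>rat_param_image n \<phi>. \<forall>i<n. rat_fun_value (\<phi> i) t (x $ i)" if "t \<notin> E" for t
  proof (rule bexI)
    let ?x = "vec n (\<lambda>i. poly (map_poly to_ac (p i)) t / poly (map_poly to_ac (q i)) t)"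
    show "\<forall>i<n. rat_fun_value (\<phi> i) t (?x $ i)"
      using that pq(1) by (auto simp: E_def intro!: rat_fun_value_Fract)
    then show "?x \<in> rat_param_image n \<phi>"
      by (auto simp: rat_param_image_def)
  qed
  have image: "\<exists>t. \<forall>i<n. rat_fun_value (\<phi> i) t (x $ i)" if "x \<in> rat_param_image n \<phi>" for x
    using that by (auto simp: rat_param_image_def)
  have basics: "finite R" "card R = n" "n > 0" "rat_param_image n \<phi> \<subseteq> carrier_vec n"
    using finite_conjugates card_conjugates[of \<alpha>] degree_min_poly_pos[of \<alpha>]
    by (auto simp: R_def n_def ext_degree_eq rat_param_image_def)
  show ?thesis
  proof (cases "c \<alpha> = 0")
    case False
    define A B \<delta> where "A \<beta> = a \<beta> / c \<beta>" and "B \<beta> = (b \<beta> * c \<beta> - a \<beta> * d \<beta>) / c \<beta> ^ 2"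
      and "\<delta> \<beta> = d \<beta> / c \<beta>" for \<beta>
    have "partial_fraction_curve n R A B \<delta> (rat_param_image n \<phi>)"
    proof (unfold_locales, goal_cases)
      case (5 \<beta>)
      then show ?case using det[of \<beta>] c[of \<beta>] False by (simp add: B_def)
    next
      case (6 x \<beta> \<gamma>)
      obtain t where t: "\<And>i. i < n \<Longrightarrow> rat_fun_value (\<phi> i) t (x $ i)"
        using image 6 by blast
      have z: "((\<Sum>i<n. x $ i * \<beta> ^ i) - A \<beta>) / B \<beta> = 1 / (t + \<delta> \<beta>)" "t + \<delta> \<beta> \<noteq> 0" if "\<beta> \<in> R" for \<beta>
        using mf(3,4)[OF that that t] c[OF that] False by (auto simp: A_def B_def \<delta>_def)
      show ?case
        unfolding z(1)[OF 6(2)] z(1)[OF 6(3)] using z(2)[OF 6(2)] z(2)[OF 6(3)]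
        by (simp add: field_simps)
    next
      case 7
      show ?case
      proof (intro exI[of _ E] conjI allI impI \<open>finite E\<close>)
        fix s assume "s \<notin> E"
        then obtain x where x: "x \<in> rat_param_image n \<phi>" "\<And>i. i < n \<Longrightarrow> rat_fun_value (\<phi> i) s (x $ i)"
          using defined by blast
        show "\<exists>x\<in>rat_param_image n \<phi>. \<forall>\<beta>\<in>R. s + \<delta> \<beta> \<noteq> 0 \<and>
            (\<Sum>i<n. x $ i * \<beta> ^ i) = A \<beta> + B \<beta> / (s + \<delta> \<beta>)"
          using mf(2,3)[OF _ _ x(2)] c False x(1) by (auto simp: A_def B_def \<delta>_def)
      qed
    qed (use basics in auto)
    then show ?thesis
      using that C by (simp add: n_def R_def)
  next
    case True
    define A B \<delta> where "A \<beta> = b \<beta> / d \<beta>" and "B \<beta> = a \<beta> / d \<beta>"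
      and "\<delta> \<beta> = (0 :: 'k alg_closure)" for \<beta>
    have nz: "a \<beta> \<noteq> 0" "d \<beta> \<noteq> 0" "c \<beta> = 0" if "\<beta> \<in> R" for \<beta>
      using det[OF that] c[OF that] True by auto
    \<comment> \<open>The pole of \<open>u\<close> is at infinity, so the parameter is replaced by its inverse.\<close>
    have "partial_fraction_curve n R A B \<delta> (rat_param_image n \<phi>)"
    proof (unfold_locales, goal_cases)
      case (5 \<beta>)
      then show ?case using nz by (simp add: B_def)
    next
      case (6 x \<beta> \<gamma>)
      obtain t where t: "\<And>i. i < n \<Longrightarrow> rat_fun_value (\<phi> i) t (x $ i)"
        using image 6 by blast
      have "((\<Sum>i<n. x $ i * \<beta> ^ i) - A \<beta>) / B \<beta> = t" if "\<beta> \<in> R" for \<beta>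
        using mf(5)[OF that that t] nz[OF that] by (auto simp: A_def B_def)
      then show ?case
        using 6 by (simp add: \<delta>_def)
    next
      case 7
      show ?case
      \<comment> \<open>Here \<open>s + \<delta> \<beta>\<close> is \<open>s\<close>, so 0 is
        excluded, and \<open>inverse s\<close> must avoid the parameters in
        \<open>E\<close>.\<close>
      proof (intro exI[of _ "insert 0 (inverse ` E)"] conjI allI impI)
        show "finite (insert 0 (inverse ` E))" using \<open>finite E\<close> by simp
        fix s assume s: "s \<notin> insert 0 (inverse ` E)"
        then have "inverse s \<notin> E" by (metis image_eqI inverse_inverse_eq insertCI)
        then obtain x where x: "x \<in> rat_param_image n \<phi>" "\<And>i. i < n \<Longrightarrow> rat_fun_value (\<phi> i) (inverse s) (x $ i)"
          using defined by blast
        show "\<exists>x\<in>rat_param_image n \<phi>. \<forall>\<beta>\<in>R. s + \<delta> \<beta> \<noteq> 0 \<and>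
            (\<Sum>i<n. x $ i * \<beta> ^ i) = A \<beta> + B \<beta> / (s + \<delta> \<beta>)"
          using mf(5)[OF _ _ x(2)] nz x(1) s by (auto simp: A_def B_def \<delta>_def divide_inverse)
      qed
    qed (use basics in auto)
    then show ?thesis
      using that C by (simp add: n_def R_def)
  qed
qed

section \<open>The cofactors of the minimal polynomial and their conjugates\<close>

text \<open>Both sides are monic of degree \<open>card R\<close> and vanish on \<open>R\<close>;
  separability supplies the equality of degree and number of conjugates.\<close>

lemma cofactor_mult:
  fixes \<alpha> :: "'k::field_char_0 alg_closure"
  defines "R \<equiv> {\<beta>. ev (min_poly \<alpha>) \<beta> = 0}"
  assumes "\<beta> \<in> R"
  shows "[:- \<beta>, 1:] * cofactor R \<beta> = map_poly to_ac (min_poly \<alpha>)"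
proof -
  have fin: "finite R" and card: "card R = degree (min_poly \<alpha>)"
    by (simp_all add: R_def finite_conjugates card_conjugates)
  have "[:- \<beta>, 1:] * cofactor R \<beta> = (\<Prod>\<gamma>\<in>R. [:- \<gamma>, 1:])"
    unfolding cofactor_def using fin assms(2) by (rule prod.remove[symmetric])
  also have "\<dots> = map_poly to_ac (min_poly \<alpha>)"
  proof (rule poly_eqI_degree_lead_coeff[of _ "card R" _ R])
    have deg: "degree (\<Prod>\<gamma>\<in>R. [:- \<gamma>, 1:]) = card R"
      by (subst degree_prod_eq_sum_degree) auto
    have "lead_coeff (\<Prod>\<gamma>\<in>R. [:- \<gamma>, 1:]) = 1"
      by (simp add: lead_coeff_prod)
    then show "poly.coeff (\<Prod>\<gamma>\<in>R. [:- \<gamma>, 1:]) (card R) = poly.coeff (map_poly to_ac (min_poly \<alpha>)) (card R)"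
      using min_poly_spec(1)[of \<alpha>] by (simp add: deg coeff_map_poly card)
    show "degree (\<Prod>\<gamma>\<in>R. [:- \<gamma>, 1:]) \<le> card R" "degree (map_poly to_ac (min_poly \<alpha>)) \<le> card R"
      using deg by (auto simp: degree_map_poly card)
    fix z assume "z \<in> R"
    then show "poly (\<Prod>\<gamma>\<in>R. [:- \<gamma>, 1:]) z = poly (map_poly to_ac (min_poly \<alpha>)) z"
      using fin by (simp add: poly_prod) (auto simp: R_def ev_def)
  qed simp
  finally show ?thesis .
qed

text \<open>Comparing coefficients in the product with \<open>t - \<beta>\<close> gives Horner's
  recursion. It yields polynomials \<open>q i\<close> that serve all conjugates at once, so an
  automorphism acts on the coefficients just by moving \<beta>.\<close>

lemma cofactor_coeff_ev:
  fixes \<alpha> :: "'k::field_char_0 alg_closure"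
  defines "R \<equiv> {\<beta>. ev (min_poly \<alpha>) \<beta> = 0}"
  obtains q where "\<And>i \<beta>. \<beta> \<in> R \<Longrightarrow> poly.coeff (cofactor R \<beta>) i = ev (q i) \<beta>"
proof -
  define M where "M = min_poly \<alpha>"
  have deg: "poly.coeff (cofactor R \<beta>) i = 0" if "i \<ge> degree M" "\<beta> \<in> R" for i \<beta>
  proof -
    have "degree (cofactor R \<beta>) \<le> card (R - {\<beta>})"
      unfolding cofactor_def by (subst degree_prod_eq_sum_degree) auto
    also have "\<dots> < card R"
      using that(2) by (intro card_Diff1_less) (auto simp: R_def finite_conjugates)
    finally show ?thesis
      using that by (intro coeff_eq_0) (simp add: R_def M_def card_conjugates)
  qed
  have rec: "poly.coeff (cofactor R \<beta>) i = to_ac (poly.coeff M (Suc i)) + \<beta> * poly.coeff (cofactor R \<beta>) (Suc i)"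
    if "\<beta> \<in> R" for i \<beta>
  proof -
    have "poly.coeff ([:- \<beta>, 1:] * cofactor R \<beta>) (Suc i) = to_ac (poly.coeff M (Suc i))"
      using cofactor_mult[of \<beta> \<alpha>] that by (simp add: R_def M_def coeff_map_poly)
    then show ?thesis by (simp add: algebra_simps)
  qed
  \<comment> \<open>Downward induction on the index: \<open>k\<close> bounds the distance to the
    degree, from where the coefficients are 0.\<close>
  have ex: "\<exists>q. \<forall>\<beta>\<in>R. poly.coeff (cofactor R \<beta>) i = ev q \<beta>" if "i + k \<ge> degree M" for i k
    using that
  proof (induction k arbitrary: i)
    case 0
    then show ?case using deg by (intro exI[of _ 0]) auto
  next
    case (Suc k)
    then have "degree M \<le> Suc i + k" by simp
    then obtain q where q: "\<forall>\<beta>\<in>R. poly.coeff (cofactor R \<beta>) (Suc i) = ev q \<beta>"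
      using Suc.IH by blast
    have "poly.coeff (cofactor R \<beta>) i = ev (pCons (poly.coeff M (Suc i)) q) \<beta>" if "\<beta> \<in> R" for \<beta>
      using rec[OF that, of i] q that by simp
    then show ?case by blast
  qed
  define q where "q i = (SOME q. \<forall>\<beta>\<in>R. poly.coeff (cofactor R \<beta>) i = ev q \<beta>)" for i
  have "\<forall>\<beta>\<in>R. poly.coeff (cofactor R \<beta>) i = ev (q i) \<beta>" for i
    unfolding q_def by (rule someI_ex, rule ex[of i "degree M"]) simp
  then show ?thesis
    by (intro that[of q]) blast
qed

lemma cofactor_coeff_top:
  fixes R :: "'a::field set"
  assumes "finite R" "\<beta> \<in> R"
  shows "poly.coeff (cofactor R \<beta>) (card R - 1) = 1"
proof -
  have "degree (cofactor R \<beta>) = card R - 1"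
    unfolding cofactor_def using assms by (subst degree_prod_eq_sum_degree) auto
  moreover have "lead_coeff (cofactor R \<beta>) = 1"
    by (simp add: cofactor_def lead_coeff_prod)
  ultimately show ?thesis by simp
qed

lemma conjugate_points_cofactor:
  fixes \<alpha> :: "'k::field_char_0 alg_closure"
  defines "R \<equiv> {\<beta>. ev (min_poly \<alpha>) \<beta> = 0}" and "n \<equiv> ext_degree \<alpha>"
  defines "V \<equiv> \<lambda>\<beta>. vec (n + 1) (\<lambda>i. if i < n then poly.coeff (cofactor R \<beta>) i else 0)"
  shows "conjugate_points (normal_closure (simple_ext \<alpha>)) (proj_point (V \<alpha>)) = (\<lambda>\<beta>. proj_point (V \<beta>)) ` R"
proof -
  let ?N = "normal_closure (simple_ext \<alpha>)"
  obtain q where q: "\<And>i \<beta>. \<beta> \<in> R \<Longrightarrow> poly.coeff (cofactor R \<beta>) i = ev (q i) \<beta>"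
    using cofactor_coeff_ev[of \<alpha>] unfolding R_def by blast
  have "\<alpha> \<in> R" by (simp add: R_def min_poly_spec(2))
  have n: "n > 0" "card R = n"
    using degree_min_poly_pos[of \<alpha>] by (simp_all add: n_def ext_degree_eq R_def card_conjugates)
  have "\<alpha> = ev [:0, 1:] \<alpha>" by simp
  then have "\<alpha> \<in> ?N"
    using normal_closure_closed(1) unfolding simple_ext_eq by (metis rangeI)
  note N = normal_closure_closed(2-4)[of _ "simple_ext \<alpha>"]
  have hom: "\<sigma> (ev p \<alpha>) = ev p (\<sigma> \<alpha>) \<and> ev p \<alpha> \<in> ?N" if "is_base_automorphism ?N \<sigma>" for \<sigma> p
    using that N \<open>\<alpha> \<in> ?N\<close> by (intro hom_ev) (auto simp: is_base_automorphism_def)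
  show ?thesis
  proof (intro equalityI subsetI)
    fix P assume "P \<in> conjugate_points ?N (proj_point (V \<alpha>))"
    then obtain \<sigma> v where \<sigma>: "is_base_automorphism ?N \<sigma>" and v: "v \<in> proj_point (V \<alpha>)"
      "\<And>i. i < dim_vec v \<Longrightarrow> v $ i \<in> ?N" and P: "P = proj_point (map_vec \<sigma> v)"
      unfolding conjugate_points_def by blast
    obtain c where c: "c \<noteq> 0" "v = c \<cdot>\<^sub>v V \<alpha>"
      using v(1) by (auto simp: proj_point_def)
    \<comment> \<open>A representative \<open>v\<close> is \<open>c\<close> times
      \<open>V \<alpha>\<close>. The entry of \<open>V \<alpha>\<close> at \<open>n - 1\<close> is
      1, so \<open>c\<close> is an entry of \<open>v\<close> and lies in the normal closure; only
      then is \<open>\<sigma>\<close> multiplicative on the products.\<close>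
    have "finite R" by (simp add: R_def finite_conjugates)
    then have "poly.coeff (cofactor R \<alpha>) (n - 1) = 1"
      using cofactor_coeff_top \<open>\<alpha> \<in> R\<close> n(2) by blast
    moreover have "n - 1 < n" using n(1) by simp
    ultimately have "n - 1 < dim_vec v" "v $ (n - 1) = c"
      using c(2) by (auto simp: V_def)
    then have "c \<in> ?N"
      using v(2) by metis
    have \<sigma>0: "\<sigma> 0 = 0"
      using \<sigma> to_ac_0 unfolding is_base_automorphism_def by metis
    have "0 \<in> ?N" using N(1)[of 0] by simp
    have \<sigma>c: "\<sigma> c \<noteq> 0"
      using \<sigma> \<sigma>0 \<open>c \<in> ?N\<close> \<open>0 \<in> ?N\<close> c(1)
      unfolding is_base_automorphism_def bij_betw_def inj_on_def by metis
    have \<sigma>R: "\<sigma> \<alpha> \<in> R"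
      using hom[OF \<sigma>, of "min_poly \<alpha>"] \<sigma>0 by (simp add: R_def min_poly_spec(2))
    have "map_vec \<sigma> v = \<sigma> c \<cdot>\<^sub>v V (\<sigma> \<alpha>)"
    proof (rule eq_vecI)
      fix i assume "i < dim_vec (\<sigma> c \<cdot>\<^sub>v V (\<sigma> \<alpha>))"
      then have "i < n + 1" by (simp add: V_def)
      moreover have "\<sigma> (c * ev (q i) \<alpha>) = \<sigma> c * ev (q i) (\<sigma> \<alpha>)"
        using hom[OF \<sigma>, of "q i"] \<sigma> \<open>c \<in> ?N\<close> by (auto simp: is_base_automorphism_def)
      ultimately show "map_vec \<sigma> v $ i = (\<sigma> c \<cdot>\<^sub>v V (\<sigma> \<alpha>)) $ i"
        using \<sigma>0 by (auto simp: c(2) V_def q[OF \<open>\<alpha> \<in> R\<close>] q[OF \<sigma>R])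
    qed (simp add: c(2) V_def)
    then show "P \<in> (\<lambda>\<beta>. proj_point (V \<beta>)) ` R"
      using P \<sigma>R proj_point_smult[OF \<sigma>c] by auto
  next
    fix P assume "P \<in> (\<lambda>\<beta>. proj_point (V \<beta>)) ` R"
    then obtain \<beta> where \<beta>: "\<beta> \<in> R" "P = proj_point (V \<beta>)" by blast
    obtain \<sigma> :: "'k alg_closure \<Rightarrow> 'k alg_closure" where \<sigma>: "\<sigma> \<alpha> = \<beta>" "\<And>k. \<sigma> (to_ac k) = to_ac k"
      "\<And>x y. \<sigma> (x + y) = \<sigma> x + \<sigma> y" "\<And>x y. \<sigma> (x * y) = \<sigma> x * \<sigma> y"
      using conjugation_extends[of \<alpha> \<beta>] \<beta>(1) unfolding R_def by blast
    have auto: "is_base_automorphism ?N \<sigma>"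
      by (rule base_automorphism_of_hom) (fact \<sigma>)+
    have "\<sigma> 0 = 0" using \<sigma>(2)[of 0] by simp
    have "V \<beta> = map_vec \<sigma> (V \<alpha>)"
      by (rule eq_vecI) (use \<open>\<sigma> 0 = 0\<close> hom[OF auto] \<sigma>(1) in
          \<open>auto simp: V_def q[OF \<open>\<alpha> \<in> R\<close>] q[OF \<beta>(1)]\<close>)
    moreover have "\<forall>i<dim_vec (V \<alpha>). V \<alpha> $ i \<in> ?N"
      using hom[OF auto] N(1)[of 0] by (auto simp: V_def q[OF \<open>\<alpha> \<in> R\<close>])
    ultimately show "P \<in> conjugate_points ?N (proj_point (V \<alpha>))"
      unfolding conjugate_points_def \<beta>(2)
      by (intro CollectI exI[of _ \<sigma>] exI[of _ "V \<alpha>"]) (simp add: auto proj_point_self)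
  qed
qed

theorem proposition4p4:
  fixes \<alpha> :: "'k::field_char_0 alg_closure"
    and n :: nat
    and m :: "'k alg_closure poly"
    and l :: "nat \<Rightarrow> 'k alg_closure"
    and P :: "'k alg_closure vec set"
  assumes n: "n = ext_degree \<alpha>"
    and m: "m = map_poly to_ac (min_poly \<alpha>) div [:- \<alpha>, 1:]"
    and l: "l = (\<lambda>i. poly.coeff m i)"
    and P: "P = proj_point (vec (n + 1) (\<lambda>i. if i < n then l i else 0))"
  shows "l (n - 1) = 1 \<and>
    (\<forall>C. primitive_hypercircle \<alpha> C \<longrightarrow>
       points_at_infinity n C =
         insert P (conjugate_points (normal_closure (simple_ext \<alpha>)) P))"
proof -
  define R where "R = {\<beta>. ev (min_poly \<alpha>) \<beta> = 0}"
  define V where "V \<beta> = vec (n + 1) (\<lambda>i. if i < n then poly.coeff (cofactor R \<beta>) i else 0)" for \<beta>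
  have "\<alpha> \<in> R" by (simp add: R_def min_poly_spec(2))
  then have "m = cofactor R \<alpha>"
    unfolding m R_def cofactor_mult[of \<alpha> \<alpha>, symmetric, folded R_def]
    by (subst cofactor_mult[symmetric]) (auto simp: R_def simp del: mult_pCons_left)
  then have l': "l = poly.coeff (cofactor R \<alpha>)"
    by (simp add: l)
  have P': "P = proj_point (V \<alpha>)"
    unfolding P V_def l' ..
  have conj: "conjugate_points (normal_closure (simple_ext \<alpha>)) P = (\<lambda>\<beta>. proj_point (V \<beta>)) ` R"
    using conjugate_points_cofactor[of \<alpha>] unfolding P' V_def R_def n .
  have "points_at_infinity n C = insert P (conjugate_points (normal_closure (simple_ext \<alpha>)) P)"
    if prim: "primitive_hypercircle \<alpha> C" for C
  proof -
    obtain A B \<delta> S where curve: "partial_fraction_curve n R A B \<delta> S" and C: "C = zariski_closure n S"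
      using prim hypercircle_partial_fractions[of \<alpha> C] unfolding primitive_hypercircle_def n R_def by blast
    interpret partial_fraction_curve n R A B \<delta> S by (fact curve)
    have "points_at_infinity n C = (\<lambda>\<beta>. proj_point (V \<beta>)) ` R"
      unfolding C V_def
      by (intro points_at_infinity_eq inj_on_of_degree) (use prim in \<open>simp add: primitive_hypercircle_def n C\<close>)
    \<comment> \<open>The point \<open>P\<close> is its own conjugate for \<beta> = \<alpha>, so
      inserting it changes nothing.\<close>
    then show ?thesis
      using conj P' \<open>\<alpha> \<in> R\<close> by auto
  qed
  moreover have "l (n - 1) = 1"
    using cofactor_coeff_top[OF _ \<open>\<alpha> \<in> R\<close>] finite_conjugates[of \<alpha>] card_conjugates[of \<alpha>]
    by (simp add: l' R_def n ext_degree_eq)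
  ultimately show ?thesis by blast
qed

end
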